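(* Let $N\ge2$, let $\Omega\subset\mathbb{R}^N$ be a bounded domain, let $2<p<2^*$, and assume that $\beta\ge1$ and $\lambda_1(\Omega)<\lambda_1\le\lambda_2$. Then the system $(LS)$ does not admit a positive vectorial solution, i.e. there is no solution $(u,v)\in H_0^1(\Omega)\times H_0^1(\Omega)$ with $u>0$ and $v>0$ in $\Omega$.
   Context: Here $2^*=2N/(N-2)$ if $N\ge3$, $2^*=\infty$ if $N=2$, and $\lambda_1(\Omega)$ is the first eigenvalue of $-\Delta$ on $\Omega$ with Dirichlet boundary condition. The system $(LS)$ is $$\begin{cases}-\Delta u=\lambda_1u-|u|^{p-2}u+\beta|u|^{\frac p2-2}u\,|v|^{\frac p2}&\text{in }\Omega,\\ -\Delta v=\lambda_2v-|v|^{p-2}v+\beta|u|^{\frac p2}|v|^{\frac p2-2}v&\text{in }\Omega,\\ u,v\in H_0^1(\Omega),\end{cases}$$ understood in the weak sense, where $|s|^{\frac p2-2}s:=0$ at $s=0$. *)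

theory Defs
  imports "HOL-Analysis.Analysis"
begin

text \<open>
  Elements of Lebesgue and Sobolev spaces on \<open>\<Omega>\<close> are represented by functions on the whole space of
  which only the almost everywhere class on \<open>\<Omega>\<close> matters.
\<close>

primrec C_k :: "nat \<Rightarrow> ('a::euclidean_space \<Rightarrow> real) \<Rightarrow> bool" where
  "C_k 0 f \<longleftrightarrow> continuous_on UNIV f"
| "C_k (Suc k) f \<longleftrightarrow>
     f differentiable_on UNIV \<and> (\<forall>b\<in>Basis. C_k k (\<lambda>x. frechet_derivative f (at x) b))"

text \<open>A function in \<open>C\<^sub>c\<^sup>\<infinity>(\<Omega>)\<close> is identified with its extension by zero.\<close>

definition test_functions :: "'a::euclidean_space set \<Rightarrow> ('a \<Rightarrow> real) set" where
  "test_functions \<Omega> =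
     {\<phi>. (\<forall>k. C_k k \<phi>) \<and> compact (closure {x. \<phi> x \<noteq> 0}) \<and> closure {x. \<phi> x \<noteq> 0} \<subseteq> \<Omega>}"

definition gradient :: "('a::euclidean_space \<Rightarrow> real) \<Rightarrow> 'a \<Rightarrow> 'a" where
  "gradient \<phi> x = (\<Sum>b\<in>Basis. frechet_derivative \<phi> (at x) b *\<^sub>R b)"

definition L2 :: "'a::euclidean_space set \<Rightarrow> ('a \<Rightarrow> 'b::euclidean_space) set" where
  "L2 \<Omega> = {f \<in> borel_measurable (lebesgue_on \<Omega>). integrable (lebesgue_on \<Omega>) (\<lambda>x. (norm (f x))\<^sup>2)}"

text \<open>
  \<open>L2_weak_gradient \<Omega> u Du\<close>: the function \<open>u\<close> and its distributional gradient \<open>Du\<close> are both square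
  integrable on \<open>\<Omega>\<close>. As \<open>Du\<close> is unique only almost everywhere, this is a relation.
\<close>

definition L2_weak_gradient ::
    "'a::euclidean_space set \<Rightarrow> ('a \<Rightarrow> real) \<Rightarrow> ('a \<Rightarrow> 'a) \<Rightarrow> bool" where
  "L2_weak_gradient \<Omega> u Du \<longleftrightarrow>
     u \<in> L2 \<Omega> \<and> Du \<in> L2 \<Omega> \<and>
     (\<forall>\<phi>\<in>test_functions \<Omega>. \<forall>b\<in>Basis.
        (LINT x|lebesgue_on \<Omega>. u x * frechet_derivative \<phi> (at x) b) =
        - (LINT x|lebesgue_on \<Omega>. (Du x \<bullet> b) * \<phi> x))"

text \<open>\<open>H\<^sub>0\<^sup>1(\<Omega>)\<close>, the closure of \<open>C\<^sub>c\<^sup>\<infinity>(\<Omega>)\<close> in the norm of \<open>H\<^sup>1(\<Omega>)\<close>.\<close>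

definition H10 :: "'a::euclidean_space set \<Rightarrow> ('a \<Rightarrow> real) set" where
  "H10 \<Omega> =
     {u. \<exists>Du. L2_weak_gradient \<Omega> u Du \<and>
        (\<exists>\<phi> :: nat \<Rightarrow> 'a \<Rightarrow> real. (\<forall>n. \<phi> n \<in> test_functions \<Omega>) \<and>
           (\<lambda>n. LINT x|lebesgue_on \<Omega>. (u x - \<phi> n x)\<^sup>2 + (norm (Du x - gradient (\<phi> n) x))\<^sup>2)
             \<longlonglongrightarrow> 0)}"

text \<open>
  Weak form of \<open>-\<Delta>u = f\<close> in \<open>\<Omega>\<close>, \<open>u \<in> H\<^sub>0\<^sup>1(\<Omega>)\<close>, tested against all of \<open>H\<^sub>0\<^sup>1(\<Omega>)\<close>.
  Using \<^const>\<open>has_bochner_integral\<close> says that the right-hand integral exists, instead of giving it the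
  value \<open>0\<close> by default when it does not. For the right-hand sides below, existence is automatic
  by the Sobolev embedding if \<open>2 < p < 2*\<close>.
\<close>

definition weak_poisson_solution ::
    "'a::euclidean_space set \<Rightarrow> ('a \<Rightarrow> real) \<Rightarrow> ('a \<Rightarrow> real) \<Rightarrow> bool" where
  "weak_poisson_solution \<Omega> f u \<longleftrightarrow>
     u \<in> H10 \<Omega> \<and>
     (\<forall>\<phi>\<in>H10 \<Omega>. \<forall>Du D\<phi>. L2_weak_gradient \<Omega> u Du \<longrightarrow> L2_weak_gradient \<Omega> \<phi> D\<phi> \<longrightarrow>
        has_bochner_integral (lebesgue_on \<Omega>) (\<lambda>x. f x * \<phi> x)
          (LINT x|lebesgue_on \<Omega>. Du x \<bullet> D\<phi> x))"

definition dirichlet_eigenvalue :: "'a::euclidean_space set \<Rightarrow> real \<Rightarrow> bool" where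
  "dirichlet_eigenvalue \<Omega> \<mu> \<longleftrightarrow>
     (\<exists>w. \<not> (AE x in lebesgue_on \<Omega>. w x = 0) \<and> weak_poisson_solution \<Omega> (\<lambda>x. \<mu> * w x) w)"

text \<open>
  The smallest Dirichlet eigenvalue. For a bounded domain the infimum is attained and positive; it is
  taken in \<^typ>\<open>ereal\<close> because there it is meaningful without presupposing this.
\<close>

definition first_dirichlet_eigenvalue :: "'a::euclidean_space set \<Rightarrow> ereal" where
  "first_dirichlet_eigenvalue \<Omega> = (INF \<mu>\<in>{\<mu>. dirichlet_eigenvalue \<Omega> \<mu>}. ereal \<mu>)"

text \<open>Only used for \<open>N \<ge> 2\<close>.\<close>

definition critical_sobolev_exponent :: "nat \<Rightarrow> ereal" where
  "critical_sobolev_exponent N = (if N \<ge> 3 then ereal (2 * real N / (real N - 2)) else \<infinity>)"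

text \<open>
  The convention \<open>|s|\<^bsup>p/2-2\<^esup> s = 0\<close> at \<open>s = 0\<close> holds automatically, since \<open>0 powr a = 0\<close>
  for every \<open>a\<close>.
\<close>

definition LS_solution ::
    "'a::euclidean_space set \<Rightarrow> real \<Rightarrow> real \<Rightarrow> real \<Rightarrow> real \<Rightarrow> ('a \<Rightarrow> real) \<Rightarrow> ('a \<Rightarrow> real) \<Rightarrow> bool"
  where
  "LS_solution \<Omega> p \<beta> l1 l2 u v \<longleftrightarrow>
     weak_poisson_solution \<Omega>
       (\<lambda>x. l1 * u x - \<bar>u x\<bar> powr (p - 2) * u x
            + \<beta> * (\<bar>u x\<bar> powr (p/2 - 2) * u x) * \<bar>v x\<bar> powr (p/2)) u \<and>
     weak_poisson_solution \<Omega>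
       (\<lambda>x. l2 * v x - \<bar>v x\<bar> powr (p - 2) * v x
            + \<beta> * \<bar>u x\<bar> powr (p/2) * (\<bar>v x\<bar> powr (p/2 - 2) * v x)) v"

end

theory Submission
  imports Defs
begin

text \<open>
  Suppose that \<open>(u, v)\<close> is a positive solution and put \<open>m = p/2\<close>. The equations read
  \<open>-\<Delta>u = u (l1 - u\<^bsup>m-2\<^esup> (u\<^bsup>m\<^esup> - \<beta> v\<^bsup>m\<^esup>))\<close> and \<open>-\<Delta>v = v (l2 - v\<^bsup>m-2\<^esup> (v\<^bsup>m\<^esup> - \<beta> u\<^bsup>m\<^esup>))\<close>. As \<open>\<beta> \<ge> 1\<close> and
  \<open>l2 \<ge> l1\<close>, the first growth rate is at least \<open>l1\<close> where \<open>u \<le> v\<close>, and the second one where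
  \<open>v \<le> u\<close>. Hence the minimum of \<open>u\<close> and \<open>v\<close> should be a positive supersolution of \<open>-\<Delta>w = l1 w\<close>,
  and by Picone's inequality the existence of such a function gives
  \<open>l1 \<integral>\<phi>\<^sup>2 \<le> \<integral>\<bar>\<nabla>\<phi>\<bar>\<^sup>2\<close> for all \<open>\<phi>\<close> in \<open>H\<^sub>0\<^sup>1(\<Omega>)\<close>. No Dirichlet eigenvalue can then lie below \<open>l1\<close>, which
  contradicts the assumption on the first one.

  Instead of the minimum, the proof uses the smooth concave function \<open>(u\<^bsup>-q\<^esup> + v\<^bsup>-q\<^esup>)\<^bsup>-1/q\<^esup>\<close> with
  \<open>q = p - 2\<close>. Its logarithm has the derivatives \<open>a/u\<close> and \<open>b/v\<close>, where \<open>a = v\<^bsup>q\<^esup> / (u\<^bsup>q\<^esup> + v\<^bsup>q\<^esup>)\<close> and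
  \<open>b = 1 - a\<close>. The first equation is tested with \<open>\<phi>\<^sup>2 a/u\<close> and the second one with \<open>\<phi>\<^sup>2 b/v\<close>, for a test
  function \<open>\<phi>\<close>, and the results are added. With \<open>X = \<nabla>u/u\<close> and \<open>Y = \<nabla>v/v\<close> the gradient terms become
  \<open>a (2\<phi> X \<bullet> \<nabla>\<phi> - \<phi>\<^sup>2 \<bar>X\<bar>\<^sup>2) + b (2\<phi> Y \<bullet> \<nabla>\<phi> - \<phi>\<^sup>2 \<bar>Y\<bar>\<^sup>2) - q a b \<phi>\<^sup>2 \<bar>X - Y\<bar>\<^sup>2\<close>, which is at most \<open>\<bar>\<nabla>\<phi>\<bar>\<^sup>2\<close>
  (\<open>picone_inequality_pair\<close>). The reaction terms are at least \<open>l1 \<phi>\<^sup>2\<close>, because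
  \<open>u\<^bsup>m\<^esup> - v\<^bsup>m\<^esup>\<close> and \<open>u\<^bsup>m-2\<^esup> a - v\<^bsup>m-2\<^esup> b\<close> have opposite signs.

  To make the test functions bounded, \<open>u\<close> and \<open>v\<close> are replaced by \<open>u + \<epsilon>\<close> and \<open>v + \<epsilon>\<close> in these
  factors. The sign argument may then fail where \<open>u\<close> or \<open>v\<close> is of order \<open>\<epsilon>\<close>, but the choice of \<open>q\<close> keeps the
  error below \<open>(2\<epsilon>)\<^bsup>q\<^esup>\<close> uniformly (\<open>reaction_lower_bound\<close>), and it disappears as \<open>\<epsilon> \<rightarrow> 0\<close>
  (\<open>energy_bound\<close>). That the weak equations may be tested with these functions is shown in
  \<open>weak_poisson_test_composite\<close> by inserting smooth approximations of \<open>u\<close> and \<open>v\<close>.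
\<close>

section \<open>Smooth functions and test functions\<close>

lemma C_k_SucI:
  assumes "\<And>x. (f has_derivative D x) (at x)" "\<And>b. b \<in> Basis \<Longrightarrow> C_k k (\<lambda>x. D x b)"
  shows "C_k (Suc k) f"
proof -
  have "D x = frechet_derivative f (at x)" for x
    using assms(1) by (rule frechet_derivative_at)
  moreover have "f differentiable_on UNIV"
    using assms(1) by (meson differentiable_def differentiable_on_def has_derivative_at_withinI)
  ultimately show ?thesis
    using assms(2) by auto
qed

lemma C_k_Suc_derivative:
  assumes "C_k (Suc k) f"
  shows "(f has_derivative frechet_derivative f (at x)) (at x)"
  using assms by (simp add: differentiable_on_def frechet_derivative_works)

lemma C_k_Suc_imp: "C_k (Suc k) f \<Longrightarrow> C_k k f"
proof (induction k arbitrary: f)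
  case 0
  then show ?case by (simp add: differentiable_imp_continuous_on)
next
  case (Suc k)
  then show ?case by (metis C_k.simps(2))
qed

lemma C_k_const: "C_k k (\<lambda>x. c)"
proof (induction k arbitrary: c)
  case (Suc k)
  show ?case by (rule C_k_SucI[where D="\<lambda>x h. 0"]) (auto intro: Suc)
qed simp

lemma C_k_add: "C_k k f \<Longrightarrow> C_k k g \<Longrightarrow> C_k k (\<lambda>x. f x + g x)"
proof (induction k arbitrary: f g)
  case 0
  then show ?case by (auto intro: continuous_intros)
next
  case (Suc k)
  show ?case
  proof (rule C_k_SucI[where D="\<lambda>x h. frechet_derivative f (at x) h + frechet_derivative g (at x) h"])
    show "((\<lambda>x. f x + g x) has_derivative
        (\<lambda>h. frechet_derivative f (at x) h + frechet_derivative g (at x) h)) (at x)" for x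
      using Suc.prems[THEN C_k_Suc_derivative] by (rule has_derivative_add)
  qed (use Suc in auto)
qed

lemma C_k_mult: "C_k k f \<Longrightarrow> C_k k g \<Longrightarrow> C_k k (\<lambda>x. f x * g x)"
proof (induction k arbitrary: f g)
  case 0
  then show ?case by (auto intro: continuous_intros)
next
  case (Suc k)
  show ?case
  proof (rule C_k_SucI[where
        D="\<lambda>x h. f x * frechet_derivative g (at x) h + frechet_derivative f (at x) h * g x"])
    show "((\<lambda>x. f x * g x) has_derivative
        (\<lambda>h. f x * frechet_derivative g (at x) h + frechet_derivative f (at x) h * g x)) (at x)" for x
      using Suc.prems[THEN C_k_Suc_derivative] by (rule has_derivative_mult)
  next
    fix b :: 'a assume "b \<in> Basis"
    then have "C_k k (\<lambda>x. frechet_derivative f (at x) b)" "C_k k (\<lambda>x. frechet_derivative g (at x) b)"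
      using Suc.prems by auto
    with Suc.prems[THEN C_k_Suc_imp]
    show "C_k k (\<lambda>x. f x * frechet_derivative g (at x) b + frechet_derivative f (at x) b * g x)"
      by (intro C_k_add Suc.IH)
  qed
qed

text \<open>
  Real powers of positive functions are the only non-polynomial operation needed: square roots,
  quotients and the weights below are all built from them. The exponent has to be generalised in the
  induction, since differentiation lowers it by one.
\<close>

lemma C_k_powr:
  assumes pos: "\<And>x. h x > 0"
  shows "C_k k h \<Longrightarrow> C_k k (\<lambda>x. h x powr a)"
proof (induction k arbitrary: a)
  case 0
  then show ?case
    by (auto intro!: continuous_on_powr simp: order_less_imp_not_eq2[OF pos])
next
  case (Suc k)
  show ?case
  proof (rule C_k_SucI[where D="\<lambda>x d. a * h x powr (a - 1) * frechet_derivative h (at x) d"])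
    show "((\<lambda>x. h x powr a) has_derivative
        (\<lambda>d. a * h x powr (a - 1) * frechet_derivative h (at x) d)) (at x)" for x
      by (rule has_derivative_eq_rhs[OF has_derivative_powr[OF C_k_Suc_derivative[OF Suc.prems]
              has_derivative_const[of a] pos UNIV_I]])
        (use pos[of x] in \<open>auto simp: fun_eq_iff powr_diff\<close>)
  next
    fix b :: 'a assume "b \<in> Basis"
    then show "C_k k (\<lambda>x. a * h x powr (a - 1) * frechet_derivative h (at x) b)"
      using Suc.prems C_k_Suc_imp[OF Suc.prems] by (intro C_k_mult C_k_const Suc.IH) auto
  qed
qed

definition smooth :: "('a::euclidean_space \<Rightarrow> real) \<Rightarrow> bool" where
  "smooth f \<longleftrightarrow> (\<forall>k. C_k k f)"

lemma smooth_const: "smooth (\<lambda>x. c)"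
  and smooth_add: "smooth f \<Longrightarrow> smooth g \<Longrightarrow> smooth (\<lambda>x. f x + g x)"
  and smooth_mult: "smooth f \<Longrightarrow> smooth g \<Longrightarrow> smooth (\<lambda>x. f x * g x)"
  and smooth_powr: "smooth f \<Longrightarrow> (\<And>x. f x > 0) \<Longrightarrow> smooth (\<lambda>x. f x powr a)"
  by (simp_all add: smooth_def C_k_const C_k_add C_k_mult C_k_powr)

lemma smooth_power2: "smooth f \<Longrightarrow> smooth (\<lambda>x. (f x)\<^sup>2)"
  by (simp add: power2_eq_square smooth_mult)

lemma smooth_has_derivative:
  "smooth f \<Longrightarrow> (f has_derivative frechet_derivative f (at x)) (at x)"
  unfolding smooth_def using C_k_Suc_derivative by blast

lemma smooth_partial:
  "smooth f \<Longrightarrow> b \<in> Basis \<Longrightarrow> smooth (\<lambda>x. frechet_derivative f (at x) b)"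
  unfolding smooth_def by (metis C_k.simps(2))

lemma smooth_continuous: "smooth f \<Longrightarrow> continuous_on S f"
  unfolding smooth_def by (metis C_k.simps(1) continuous_on_subset subset_UNIV)

lemma smooth_gradient_continuous: "smooth f \<Longrightarrow> continuous_on S (gradient f)"
  unfolding gradient_def by (intro continuous_intros smooth_continuous smooth_partial)

lemma gradient_eqI:
  assumes "(f has_derivative (\<lambda>h. g \<bullet> h)) (at x)"
  shows "gradient f x = g"
  unfolding gradient_def frechet_derivative_at[OF assms, symmetric] by (rule euclidean_representation)

lemma has_derivative_gradient:
  assumes "smooth f"
  shows "(f has_derivative (\<lambda>h. gradient f x \<bullet> h)) (at x)"
proof -
  note d = smooth_has_derivative[OF assms, of x]
  interpret bounded_linear "frechet_derivative f (at x)"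
    using d by (rule has_derivative_bounded_linear)
  have "frechet_derivative f (at x) h = gradient f x \<bullet> h" for h
  proof -
    have "frechet_derivative f (at x) h = frechet_derivative f (at x) (\<Sum>b\<in>Basis. (h \<bullet> b) *\<^sub>R b)"
      by (simp add: euclidean_representation)
    also have "\<dots> = gradient f x \<bullet> h"
      by (simp add: sum scaleR gradient_def inner_sum_left inner_commute[of h] mult.commute)
    finally show ?thesis .
  qed
  then show ?thesis using d by presburger
qed

lemma gradient_inner_Basis:
  "b \<in> Basis \<Longrightarrow> gradient f x \<bullet> b = frechet_derivative f (at x) b"
  by (simp add: gradient_def)

lemma test_functions_iff:
  "\<phi> \<in> test_functions \<Omega> \<longleftrightarrow>
    smooth \<phi> \<and> compact (closure {x. \<phi> x \<noteq> 0}) \<and> closure {x. \<phi> x \<noteq> 0} \<subseteq> \<Omega>"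
  by (simp add: test_functions_def smooth_def)

lemma test_functions_smooth: "\<phi> \<in> test_functions \<Omega> \<Longrightarrow> smooth \<phi>"
  by (simp add: test_functions_iff)

lemma test_functions_mult:
  assumes "\<phi> \<in> test_functions \<Omega>" "smooth g"
  shows "(\<lambda>x. \<phi> x * g x) \<in> test_functions \<Omega>"
proof -
  have "closure {x. \<phi> x * g x \<noteq> 0} \<subseteq> closure {x. \<phi> x \<noteq> 0}"
    by (rule closure_mono) auto
  then show ?thesis
    using assms compact_Int_closed[of "closure {x. \<phi> x \<noteq> 0}" "closure {x. \<phi> x * g x \<noteq> 0}"]
    unfolding test_functions_iff by (auto intro: smooth_mult simp: Int_absorb1)
qed

lemma gradient_zero_off_support:
  assumes "x \<notin> closure {x. \<phi> x \<noteq> 0}"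
  shows "gradient \<phi> x = 0"
proof (rule gradient_eqI)
  have "((\<lambda>y. 0::real) has_derivative (\<lambda>h. 0)) (at x)" by simp
  then have "(\<phi> has_derivative (\<lambda>h. 0)) (at x)"
    by (rule has_derivative_transform_within_open[where s="- closure {x. \<phi> x \<noteq> 0}"])
      (use assms closure_subset[of "{x. \<phi> x \<noteq> 0}"] in auto)
  then show "(\<phi> has_derivative (\<lambda>h. 0 \<bullet> h)) (at x)" by simp
qed

section \<open>Integration by parts for test functions\<close>

lemma lborel_integral_translate:
  fixes f :: "'a::euclidean_space \<Rightarrow> real"
  assumes "f \<in> borel_measurable borel"
  shows "(LINT x|lborel. f (c + x)) = (LINT x|lborel. f x)"
  using integral_distr[of "(+) c" lborel borel f] assms by (simp add: lborel_distr_plus)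

lemma lborel_integrable_translate:
  fixes f :: "'a::euclidean_space \<Rightarrow> real"
  assumes "integrable lborel f"
  shows "integrable lborel (\<lambda>x. f (c + x))"
  using integrable_distr[of "(+) c" lborel borel f] assms by (simp add: lborel_distr_plus)

lemma integrable_lborel_compact_support:
  fixes f :: "'a::euclidean_space \<Rightarrow> 'b::{banach,second_countable_topology}"
  assumes "continuous_on UNIV f" "compact K" "\<And>x. x \<notin> K \<Longrightarrow> f x = 0"
  shows "integrable lborel f"
proof -
  have "(\<lambda>x. indicator K x *\<^sub>R f x) = f"
    using assms(3) by (auto simp: fun_eq_iff indicator_def)
  then show ?thesis
    using borel_integrable_compact[OF assms(2), of f] assms(1) continuous_on_subset by fastforce
qed

text \<open>
  The derivative is the limit of difference quotients along \<open>b\<close>. Each quotient has integral zero,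
  because Lebesgue measure is translation invariant, and the mean value theorem bounds all of them by
  one constant on one compact set.
\<close>

lemma integral_partial_derivative_zero:
  fixes f :: "'a::euclidean_space \<Rightarrow> real"
  assumes "f \<in> test_functions \<Omega>" and b: "b \<in> Basis"
  shows "(LINT x|lborel. frechet_derivative f (at x) b) = 0"
proof -
  define K where "K = closure {x. f x \<noteq> 0}"
  define d where "d = (\<lambda>x. frechet_derivative f (at x) b)"
  have sm: "smooth f" and K: "compact K"
    using assms by (auto simp: test_functions_iff K_def)
  have d_cont: "continuous_on UNIV d"
    unfolding d_def by (intro smooth_continuous smooth_partial sm b)
  have d0: "d x = 0" if "x \<notin> K" for x
    using gradient_zero_off_support[of x f] that gradient_inner_Basis[OF b, of f x]
    unfolding K_def d_def by simp
  have f0: "f x = 0" if "x \<notin> K" for x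
    using that closure_subset[of "{x. f x \<noteq> 0}"] unfolding K_def by auto
  obtain L where L: "\<And>x. \<bar>d x\<bar> \<le> L" and "L \<ge> 0"
  proof -
    have "bounded (d ` K)"
      using compact_continuous_image[OF continuous_on_subset[OF d_cont] K] compact_imp_bounded by auto
    then obtain L where "\<And>x. x \<in> K \<Longrightarrow> \<bar>d x\<bar> \<le> L" "L > 0" by (auto simp: bounded_pos)
    then show ?thesis using d0 by (intro that[of L]) (metis abs_zero less_imp_le)+
  qed
  define t where "t = (\<lambda>n. 1 / real (Suc n))"
  have t: "0 < t n" "t n \<le> 1" for n by (auto simp: t_def divide_simps)
  have t_lim: "t \<longlonglongrightarrow> 0" unfolding t_def by (rule LIMSEQ_Suc[OF lim_1_over_n])
  define g where "g = (\<lambda>n x. (f (t n *\<^sub>R b + x) - f x) / t n)"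
  \<comment> \<open>For steps in \<open>[0,1]\<close> all difference quotients vanish off this set.\<close>
  define K' where "K' = (\<lambda>(x, s). x - s *\<^sub>R b) ` (K \<times> {0..1})"
  have K': "compact K'"
    unfolding K'_def by (intro compact_continuous_image compact_Times K)
      (auto intro!: continuous_intros simp: case_prod_beta)
  have line: "((\<lambda>s. f (s *\<^sub>R b + x)) has_real_derivative d (s *\<^sub>R b + x)) (at s)" for s x
  proof -
    have lin: "linear (frechet_derivative f (at (s *\<^sub>R b + x)))"
      using smooth_has_derivative[OF sm] has_derivative_linear by blast
    have "((\<lambda>s. f (s *\<^sub>R b + x)) has_derivative (\<lambda>h. frechet_derivative f (at (s *\<^sub>R b + x)) (h *\<^sub>R b))) (at s)"
      by (rule has_derivative_compose[OF _ smooth_has_derivative[OF sm]]) (auto intro!: derivative_eq_intros)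
    then show ?thesis
      by (simp add: has_field_derivative_def d_def linear_scale[OF lin] mult.commute[of _ "frechet_derivative _ _ _"]
          mult_commute_abs)
  qed
  have g_bound: "\<bar>g n x\<bar> \<le> L * indicator K' x" for n x
  proof (cases "x \<in> K'")
    case True
    have "\<exists>z>0. z < t n \<and> f (t n *\<^sub>R b + x) - f (0 *\<^sub>R b + x) = (t n - 0) * d (z *\<^sub>R b + x)"
      by (rule MVT2) (use t line in auto)
    then obtain z where "f (t n *\<^sub>R b + x) - f x = t n * d (z *\<^sub>R b + x)" by auto
    then show ?thesis using t(1)[of n] L True by (simp add: g_def)
  next
    case False
    have "x \<notin> K"
    proof
      assume "x \<in> K"
      then have "x \<in> K'"
        unfolding K'_def by (intro image_eqI[of _ _ "(x, 0)"]) auto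
      with False show False by simp
    qed
    moreover have "t n *\<^sub>R b + x \<notin> K"
    proof
      assume "t n *\<^sub>R b + x \<in> K"
      then have "x \<in> K'"
        unfolding K'_def using t[of n] by (intro image_eqI[of _ _ "(t n *\<^sub>R b + x, t n)"]) auto
      with False show False by simp
    qed
    ultimately show ?thesis using f0 False by (simp add: g_def)
  qed
  have g_lim: "(\<lambda>n. g n x) \<longlonglongrightarrow> d x" for x
  proof -
    have "((\<lambda>h. (f ((0 + h) *\<^sub>R b + x) - f (0 *\<^sub>R b + x)) / h) \<longlongrightarrow> d (0 *\<^sub>R b + x)) (at 0)"
      using line[of x 0] unfolding DERIV_def .
    then have "((\<lambda>h. (f (h *\<^sub>R b + x) - f x) / h) \<longlongrightarrow> d x) (at 0)" by simp
    moreover have "filterlim t (at 0) sequentially"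
      using t_lim t(1) by (simp add: filterlim_at order_less_imp_not_eq2)
    ultimately show ?thesis unfolding g_def by (rule filterlim_compose)
  qed
  have f_meas: "f \<in> borel_measurable borel"
    using smooth_continuous[OF sm] by (rule borel_measurable_continuous_onI)
  have f_int: "integrable lborel f"
    by (rule integrable_lborel_compact_support[OF smooth_continuous[OF sm] K f0])
  have g_int: "(LINT x|lborel. g n x) = 0" for n
    unfolding g_def
    using f_int lborel_integrable_translate[OF f_int] lborel_integral_translate[OF f_meas]
    by simp
  have "(\<lambda>n. LINT x|lborel. g n x) \<longlonglongrightarrow> (LINT x|lborel. d x)"
  proof (rule integral_dominated_convergence[where w="\<lambda>x. L * indicator K' x"])
    show "d \<in> borel_measurable lborel"
      using borel_measurable_continuous_onI[OF d_cont] by simp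
    show "g n \<in> borel_measurable lborel" for n
      using f_meas unfolding g_def by measurable
    show "integrable lborel (\<lambda>x. L * indicator K' x)"
      using K' emeasure_compact_finite[OF K'] by (intro integrable_mult_right integrable_real_indicator)
        (auto simp: borel_compact top.not_eq_extremum)
    show "AE x in lborel. (\<lambda>n. g n x) \<longlonglongrightarrow> d x"
      using g_lim by (intro AE_I2)
    show "AE x in lborel. norm (g n x) \<le> L * indicator K' x" for n
      using g_bound by (intro AE_I2) simp
  qed
  then show ?thesis
    using g_int LIMSEQ_unique[OF _ tendsto_const] unfolding d_def by simp
qed

lemma integral_lebesgue_on_eq_lborel:
  fixes f :: "'a::euclidean_space \<Rightarrow> real"
  assumes "\<Omega> \<in> sets lebesgue" "f \<in> borel_measurable borel" "\<And>x. x \<notin> \<Omega> \<Longrightarrow> f x = 0"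
  shows "(LINT x|lebesgue_on \<Omega>. f x) = (LINT x|lborel. f x)"
proof -
  have "(\<lambda>x. indicator \<Omega> x *\<^sub>R f x) = f"
    using assms(3) by (auto simp: fun_eq_iff indicator_def)
  then show ?thesis
    using assms(1,2) integral_restrict_space[of \<Omega> lebesgue f] integral_completion[of f lborel] by simp
qed

lemma integrable_lebesgue_on_if_lborel:
  fixes f :: "'a::euclidean_space \<Rightarrow> real"
  assumes "\<Omega> \<in> sets lebesgue" "integrable lborel f"
  shows "integrable (lebesgue_on \<Omega>) f"
proof -
  have "integrable lebesgue f"
    using assms(2) integrable_completion[of f lborel] by (simp add: borel_measurable_integrable)
  then have "integrable lebesgue (\<lambda>x. indicator \<Omega> x *\<^sub>R f x)"
    using assms(1) by (intro integrable_mult_indicator)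
  then show ?thesis
    using assms(1) integrable_restrict_space[of \<Omega> lebesgue f] by simp
qed

lemma test_functions_support:
  assumes "\<phi> \<in> test_functions \<Omega>" "x \<notin> \<Omega>"
  shows "\<phi> x = 0" "gradient \<phi> x = 0"
proof -
  have "x \<notin> closure {x. \<phi> x \<noteq> 0}"
    using assms by (auto simp: test_functions_iff)
  then show "gradient \<phi> x = 0" by (rule gradient_zero_off_support)
  show "\<phi> x = 0"
    using \<open>x \<notin> closure {x. \<phi> x \<noteq> 0}\<close> closure_subset[of "{x. \<phi> x \<noteq> 0}"] by auto
qed

lemma test_functions_integrable:
  fixes F :: "real \<Rightarrow> 'a::euclidean_space \<Rightarrow> 'b::{banach,second_countable_topology}"
  assumes "\<phi> \<in> test_functions \<Omega>"
    and "continuous_on UNIV (\<lambda>x. F (\<phi> x) (gradient \<phi> x))" "F 0 0 = 0"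
  shows "integrable lborel (\<lambda>x. F (\<phi> x) (gradient \<phi> x))"
proof (rule integrable_lborel_compact_support[where K="closure {x. \<phi> x \<noteq> 0}"])
  show "compact (closure {x. \<phi> x \<noteq> 0})" using assms by (simp add: test_functions_iff)
  fix x assume x: "x \<notin> closure {x. \<phi> x \<noteq> 0}"
  then have "\<phi> x = 0" using closure_subset[of "{x. \<phi> x \<noteq> 0}"] by auto
  then show "F (\<phi> x) (gradient \<phi> x) = 0"
    using gradient_zero_off_support[OF x] assms(3) by simp
qed (rule assms(2))

lemma test_functions_bounded:
  assumes "\<phi> \<in> test_functions \<Omega>"
  obtains C where "C > 0" "\<And>x. \<bar>\<phi> x\<bar> \<le> C" "\<And>x. norm (gradient \<phi> x) \<le> C"
proof -
  define K where "K = closure {x. \<phi> x \<noteq> 0}"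
  have sm: "smooth \<phi>" and K: "compact K"
    using assms by (auto simp: test_functions_iff K_def)
  have "bounded (\<phi> ` K)"
    by (intro compact_imp_bounded compact_continuous_image K smooth_continuous sm)
  then obtain A where A: "A > 0" "\<And>x. x \<in> K \<Longrightarrow> \<bar>\<phi> x\<bar> \<le> A"
    by (auto simp: bounded_pos)
  have "bounded (gradient \<phi> ` K)"
    by (intro compact_imp_bounded compact_continuous_image K smooth_gradient_continuous sm)
  then obtain B where B: "B > 0" "\<And>x. x \<in> K \<Longrightarrow> norm (gradient \<phi> x) \<le> B"
    by (auto simp: bounded_pos)
  have "\<bar>\<phi> x\<bar> \<le> A + B \<and> norm (gradient \<phi> x) \<le> A + B" for x
  proof (cases "x \<in> K")
    case True
    then show ?thesis using A(1) A(2)[OF True] B(1) B(2)[OF True] by simp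
  next
    case False
    then have "\<phi> x = 0" "gradient \<phi> x = 0"
      using gradient_zero_off_support[of x \<phi>] closure_subset[of "{x. \<phi> x \<noteq> 0}"]
      unfolding K_def by auto
    then show ?thesis using A(1) B(1) by simp
  qed
  then show thesis
    using A(1) B(1) by (intro that[of "A + B"]) auto
qed

lemma smooth_measurable_lebesgue_on:
  assumes "smooth \<phi>" "\<Omega> \<in> sets lebesgue"
  shows "\<phi> \<in> borel_measurable (lebesgue_on \<Omega>)" "gradient \<phi> \<in> borel_measurable (lebesgue_on \<Omega>)"
  using assms by (auto intro!: continuous_imp_measurable_on_sets_lebesgue smooth_continuous
      smooth_gradient_continuous)

lemma test_functions_L2:
  assumes "\<phi> \<in> test_functions \<Omega>" "\<Omega> \<in> sets lebesgue"
  shows "\<phi> \<in> L2 \<Omega>" "gradient \<phi> \<in> L2 \<Omega>"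
proof -
  note sm = test_functions_smooth[OF assms(1)]
  have "integrable lborel (\<lambda>x. (norm (\<phi> x))\<^sup>2)" 
    by (rule test_functions_integrable[OF assms(1), where F="\<lambda>s y. (norm s)\<^sup>2"])
      (auto intro!: continuous_intros smooth_continuous[OF sm])
  moreover have "integrable lborel (\<lambda>x. (norm (gradient \<phi> x))\<^sup>2)"
    by (rule test_functions_integrable[OF assms(1), where F="\<lambda>s y. (norm y)\<^sup>2"])
      (auto intro!: continuous_intros smooth_gradient_continuous sm)
  ultimately show "\<phi> \<in> L2 \<Omega>" "gradient \<phi> \<in> L2 \<Omega>"
    using assms(2) smooth_measurable_lebesgue_on[OF sm] integrable_lebesgue_on_if_lborel
    by (auto simp: L2_def)
qed

text \<open>
  Integration by parts: the product with a second test function is again a test function, and its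
  partial derivatives integrate to zero.
\<close>

lemma test_functions_weak_gradient:
  assumes \<psi>: "\<psi> \<in> test_functions \<Omega>" and "\<Omega> \<in> sets lebesgue"
  shows "L2_weak_gradient \<Omega> \<psi> (gradient \<psi>)"
  unfolding L2_weak_gradient_def
proof (intro conjI ballI)
  fix \<phi> :: "'a \<Rightarrow> real" and b :: 'a
  assume \<phi>: "\<phi> \<in> test_functions \<Omega>" and b: "b \<in> Basis"
  let ?D = "\<lambda>f x. frechet_derivative f (at x) b"
  note sm = test_functions_smooth[OF \<psi>] test_functions_smooth[OF \<phi>]
  have prod: "?D (\<lambda>x. \<psi> x * \<phi> x) x = \<psi> x * ?D \<phi> x + ?D \<psi> x * \<phi> x" for x
    using frechet_derivative_at[OF has_derivative_mult[OF sm[THEN smooth_has_derivative, of x]], symmetric]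
    by simp
  have supp: "\<psi> x * ?D \<phi> x = 0" "?D \<psi> x * \<phi> x = 0" if "x \<notin> \<Omega>" for x
    using that test_functions_support[OF \<phi>] test_functions_support[OF \<psi>] b
    by (simp_all flip: gradient_inner_Basis)
  have cont: "continuous_on UNIV (\<lambda>x. \<psi> x * ?D \<phi> x)" "continuous_on UNIV (\<lambda>x. ?D \<psi> x * \<phi> x)"
    using b sm by (auto intro!: smooth_continuous smooth_mult smooth_partial)
  have "integrable lborel (\<lambda>x. \<psi> x * ?D \<phi> x)"
  proof (rule integrable_lborel_compact_support[OF cont(1)])
    show "compact (closure {x. \<psi> x \<noteq> 0})" using \<psi> by (simp add: test_functions_iff)
    show "\<psi> x * ?D \<phi> x = 0" if "x \<notin> closure {x. \<psi> x \<noteq> 0}" for x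
      using that closure_subset[of "{x. \<psi> x \<noteq> 0}"] by auto
  qed
  moreover have "integrable lborel (\<lambda>x. ?D \<psi> x * \<phi> x)"
  proof (rule integrable_lborel_compact_support[OF cont(2)])
    show "compact (closure {x. \<phi> x \<noteq> 0})" using \<phi> by (simp add: test_functions_iff)
    show "?D \<psi> x * \<phi> x = 0" if "x \<notin> closure {x. \<phi> x \<noteq> 0}" for x
      using that closure_subset[of "{x. \<phi> x \<noteq> 0}"] by auto
  qed
  ultimately have "(LINT x|lborel. \<psi> x * ?D \<phi> x) + (LINT x|lborel. ?D \<psi> x * \<phi> x)
      = (LINT x|lborel. ?D (\<lambda>x. \<psi> x * \<phi> x) x)"
    by (simp add: prod)
  also have "\<dots> = 0"
    by (rule integral_partial_derivative_zero[OF test_functions_mult[OF \<psi> sm(2)] b])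
  finally have "(LINT x|lborel. \<psi> x * ?D \<phi> x) = - (LINT x|lborel. ?D \<psi> x * \<phi> x)" by simp
  then show "(LINT x|lebesgue_on \<Omega>. \<psi> x * ?D \<phi> x) = - (LINT x|lebesgue_on \<Omega>. (gradient \<psi> x \<bullet> b) * \<phi> x)"
    using integral_lebesgue_on_eq_lborel[OF assms(2) borel_measurable_continuous_onI[OF cont(1)] supp(1)]
      integral_lebesgue_on_eq_lborel[OF assms(2) borel_measurable_continuous_onI[OF cont(2)] supp(2)] b
    by (simp add: gradient_inner_Basis)
qed (use test_functions_L2[OF assms] in auto)

lemma test_functions_H10:
  assumes "\<psi> \<in> test_functions \<Omega>" "\<Omega> \<in> sets lebesgue"
  shows "\<psi> \<in> H10 \<Omega>"
  unfolding H10_def mem_Collect_eq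
  using assms by (intro exI[of _ "gradient \<psi>"] conjI test_functions_weak_gradient exI[of _ "\<lambda>n::nat. \<psi>"]) auto

section \<open>Limits in \<open>L\<^sup>2\<close> and approximation in \<open>H\<^sub>0\<^sup>1\<close>\<close>

lemma L2_measurable: "f \<in> L2 \<Omega> \<Longrightarrow> f \<in> borel_measurable (lebesgue_on \<Omega>)"
  and L2_integrable: "f \<in> L2 \<Omega> \<Longrightarrow> integrable (lebesgue_on \<Omega>) (\<lambda>x. (norm (f x))\<^sup>2)"
  by (auto simp: L2_def)

lemma L2_integrable_mult:
  assumes "f \<in> L2 \<Omega>" "g \<in> L2 \<Omega>"
  shows "integrable (lebesgue_on \<Omega>) (\<lambda>x. norm (f x) * norm (g x))"
proof (rule Bochner_Integration.integrable_bound)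
  show "integrable (lebesgue_on \<Omega>) (\<lambda>x. (norm (f x))\<^sup>2 + (norm (g x))\<^sup>2)"
    using assms[THEN L2_integrable] by simp
  have "norm (f x) * norm (g x) \<le> (norm (f x))\<^sup>2 + (norm (g x))\<^sup>2" for x
    using sum_squares_bound[of "norm (f x)" "norm (g x)"] mult_nonneg_nonneg[OF norm_ge_zero norm_ge_zero, of "f x" "g x"]
    by linarith
  then show "AE x in lebesgue_on \<Omega>.
      norm (norm (f x) * norm (g x)) \<le> norm ((norm (f x))\<^sup>2 + (norm (g x))\<^sup>2)"
    by (simp add: abs_mult)
qed (use assms[THEN L2_measurable] in measurable)

lemma L2_diff:
  assumes "f \<in> L2 \<Omega>" "g \<in> L2 \<Omega>"
  shows "(\<lambda>x. f x - g x) \<in> L2 \<Omega>"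
proof -
  have "integrable (lebesgue_on \<Omega>) (\<lambda>x. (norm (f x - g x))\<^sup>2)"
  proof (rule Bochner_Integration.integrable_bound)
    show "integrable (lebesgue_on \<Omega>) (\<lambda>x. 2 * ((norm (f x))\<^sup>2 + (norm (g x))\<^sup>2))"
      using assms[THEN L2_integrable] by simp
    have "(norm (f x - g x))\<^sup>2 \<le> 2 * ((norm (f x))\<^sup>2 + (norm (g x))\<^sup>2)" for x
    proof -
      have "(norm (f x - g x))\<^sup>2 \<le> (norm (f x) + norm (g x))\<^sup>2"
        by (simp add: norm_triangle_ineq4)
      also have "\<dots> \<le> 2 * ((norm (f x))\<^sup>2 + (norm (g x))\<^sup>2)"
        using sum_squares_bound[of "norm (f x)" "norm (g x)"] by (simp add: power2_sum)
      finally show ?thesis .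
    qed
    then show "AE x in lebesgue_on \<Omega>.
        norm ((norm (f x - g x))\<^sup>2) \<le> norm (2 * ((norm (f x))\<^sup>2 + (norm (g x))\<^sup>2))"
      by simp
  qed (use assms[THEN L2_measurable] in measurable)
  with assms[THEN L2_measurable] show ?thesis by (simp add: L2_def)
qed

lemma L2_Cauchy_Schwarz:
  assumes "f \<in> L2 \<Omega>" "g \<in> L2 \<Omega>"
  shows "(LINT x|lebesgue_on \<Omega>. norm (f x) * norm (g x))
    \<le> sqrt (LINT x|lebesgue_on \<Omega>. (norm (f x))\<^sup>2) * sqrt (LINT x|lebesgue_on \<Omega>. (norm (g x))\<^sup>2)"
proof -
  let ?M = "lebesgue_on \<Omega>"
  note meas = assms[THEN L2_measurable]
  have sq: "(\<integral>\<^sup>+x. (ennreal (norm (f x)))\<^sup>2 \<partial>?M) = ennreal (LINT x|?M. (norm (f x))\<^sup>2)"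
    "(\<integral>\<^sup>+x. (ennreal (norm (g x)))\<^sup>2 \<partial>?M) = ennreal (LINT x|?M. (norm (g x))\<^sup>2)"
    unfolding ennreal_power[OF norm_ge_zero]
    by (rule nn_integral_eq_integral[OF L2_integrable[OF assms(1)]], simp)
      (rule nn_integral_eq_integral[OF L2_integrable[OF assms(2)]], simp)
  have nonneg: "(LINT x|?M. norm (f x) * norm (g x)) \<ge> 0"
      "(LINT x|?M. (norm (f x))\<^sup>2) \<ge> 0" "(LINT x|?M. (norm (g x))\<^sup>2) \<ge> 0"
    by (rule Bochner_Integration.integral_nonneg, simp)+
  have "(\<integral>\<^sup>+x. ennreal (norm (f x)) * ennreal (norm (g x)) \<partial>?M)
      = ennreal (LINT x|?M. norm (f x) * norm (g x))"
    unfolding ennreal_mult[OF norm_ge_zero norm_ge_zero, symmetric]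
    by (rule nn_integral_eq_integral[OF L2_integrable_mult[OF assms]]) simp
  moreover have "(\<integral>\<^sup>+x. ennreal (norm (f x)) * ennreal (norm (g x)) \<partial>?M)\<^sup>2
      \<le> (\<integral>\<^sup>+x. (ennreal (norm (f x)))\<^sup>2 \<partial>?M) * (\<integral>\<^sup>+x. (ennreal (norm (g x)))\<^sup>2 \<partial>?M)"
    by (rule Cauchy_Schwarz_nn_integral)
      (rule measurable_compose[OF _ measurable_ennreal],
       rule measurable_compose[OF meas(1) borel_measurable_norm],
       rule measurable_compose[OF _ measurable_ennreal],
       rule measurable_compose[OF meas(2) borel_measurable_norm])
  ultimately have "ennreal ((LINT x|?M. norm (f x) * norm (g x))\<^sup>2)
      \<le> ennreal ((LINT x|?M. (norm (f x))\<^sup>2) * (LINT x|?M. (norm (g x))\<^sup>2))"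
    unfolding sq ennreal_mult[OF nonneg(2,3)] ennreal_power[OF nonneg(1), symmetric] by metis
  then have "(LINT x|?M. norm (f x) * norm (g x))\<^sup>2
      \<le> (LINT x|?M. (norm (f x))\<^sup>2) * (LINT x|?M. (norm (g x))\<^sup>2)"
    using nonneg by (subst (asm) ennreal_le_iff) (rule mult_nonneg_nonneg)
  then show ?thesis
    unfolding real_sqrt_mult[symmetric] by (rule real_le_rsqrt)
qed

text \<open>
  The limit passage for the gradient terms. The gradients converge strongly, the bounded coefficients
  only almost everywhere, so the two limits are taken one after the other: Cauchy-Schwarz replaces
  the gradients by their limit, dominated convergence then treats the coefficients.
\<close>

lemma L2_tendsto_integral:
  fixes h g :: "'a::euclidean_space \<Rightarrow> 'b::euclidean_space"
  assumes h: "h \<in> L2 \<Omega>" and g: "g \<in> L2 \<Omega>" and gn: "\<And>n. gn n \<in> L2 \<Omega>"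
    and conv: "(\<lambda>n. LINT x|lebesgue_on \<Omega>. (norm (g x - gn n x))\<^sup>2) \<longlonglongrightarrow> 0"
    and [measurable]: "k \<in> borel_measurable (lebesgue_on \<Omega>)"
      "\<And>n. kn n \<in> borel_measurable (lebesgue_on \<Omega>)"
    and bound: "\<And>n x. \<bar>kn n x\<bar> \<le> C"
    and AE_conv: "AE x in lebesgue_on \<Omega>. (\<lambda>n. kn n x) \<longlonglongrightarrow> k x"
  shows "(\<lambda>n. LINT x|lebesgue_on \<Omega>. kn n x * (h x \<bullet> gn n x)) \<longlonglongrightarrow> (LINT x|lebesgue_on \<Omega>. k x * (h x \<bullet> g x))"
proof -
  let ?M = "lebesgue_on \<Omega>"
  note [measurable] = L2_measurable[OF h] L2_measurable[OF g] L2_measurable[OF gn]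
  note hg_int = L2_integrable_mult[OF h g]
  note hd_int = L2_integrable_mult[OF h L2_diff[OF g gn]]
  have C: "C \<ge> 0" using bound[of 0 undefined] by linarith
  have le: "\<bar>kn n x * (h x \<bullet> y)\<bar> \<le> C * (norm (h x) * norm y)" for n x y
    unfolding abs_mult by (intro mult_mono bound Cauchy_Schwarz_ineq2 C) simp
  have int1: "integrable ?M (\<lambda>x. kn n x * (h x \<bullet> g x))" for n
    by (rule Bochner_Integration.integrable_bound[OF integrable_mult_right[OF hg_int, of C]]) (use le C in \<open>auto simp: abs_mult\<close>)
  have int2: "integrable ?M (\<lambda>x. kn n x * (h x \<bullet> (g x - gn n x)))" for n
    by (rule Bochner_Integration.integrable_bound[OF integrable_mult_right[OF hd_int, of C]]) (use le C in \<open>auto simp: abs_mult\<close>)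
  have "(\<lambda>n. LINT x|?M. kn n x * (h x \<bullet> g x)) \<longlonglongrightarrow> (LINT x|?M. k x * (h x \<bullet> g x))"
  proof (rule integral_dominated_convergence)
    show "integrable ?M (\<lambda>x. C * (norm (h x) * norm (g x)))"
      using hg_int by simp
    show "AE x in ?M. (\<lambda>n. kn n x * (h x \<bullet> g x)) \<longlonglongrightarrow> k x * (h x \<bullet> g x)"
      using AE_conv by eventually_elim (intro tendsto_intros)
    show "AE x in ?M. norm (kn n x * (h x \<bullet> g x)) \<le> C * (norm (h x) * norm (g x))" for n
      using le by simp
  qed measurable
  moreover have "(\<lambda>n. LINT x|?M. kn n x * (h x \<bullet> (g x - gn n x))) \<longlonglongrightarrow> 0"
  proof (rule Lim_null_comparison)
    let ?b = "\<lambda>n. C * (sqrt (LINT x|?M. (norm (h x))\<^sup>2) * sqrt (LINT x|?M. (norm (g x - gn n x))\<^sup>2))"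
    show "\<forall>\<^sub>F n in sequentially. norm (LINT x|?M. kn n x * (h x \<bullet> (g x - gn n x))) \<le> ?b n"
    proof (intro always_eventually allI)
      fix n
      have "norm (LINT x|?M. kn n x * (h x \<bullet> (g x - gn n x))) \<le> (LINT x|?M. \<bar>kn n x * (h x \<bullet> (g x - gn n x))\<bar>)"
        using integral_norm_bound[of ?M "\<lambda>x. kn n x * (h x \<bullet> (g x - gn n x))"] by simp
      also have "\<dots> \<le> (LINT x|?M. C * (norm (h x) * norm (g x - gn n x)))"
        by (rule integral_mono) (use int2 hd_int le in auto)
      also have "\<dots> \<le> ?b n"
        using L2_Cauchy_Schwarz[OF h L2_diff[OF g gn]] C by (simp add: mult_left_mono)
      finally show "norm (LINT x|?M. kn n x * (h x \<bullet> (g x - gn n x))) \<le> ?b n" .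
    qed
    have "(\<lambda>n. sqrt (LINT x|?M. (norm (g x - gn n x))\<^sup>2)) \<longlonglongrightarrow> sqrt 0"
      by (intro tendsto_real_sqrt conv)
    from tendsto_mult_left[OF tendsto_mult_left[OF this]] show "?b \<longlonglongrightarrow> 0"
      by simp
  qed
  ultimately have "(\<lambda>n. (LINT x|?M. kn n x * (h x \<bullet> g x)) - (LINT x|?M. kn n x * (h x \<bullet> (g x - gn n x))))
      \<longlonglongrightarrow> (LINT x|?M. k x * (h x \<bullet> g x)) - 0"
    by (rule tendsto_diff)
  moreover have "(LINT x|?M. kn n x * (h x \<bullet> g x)) - (LINT x|?M. kn n x * (h x \<bullet> (g x - gn n x)))
      = (LINT x|?M. kn n x * (h x \<bullet> gn n x))" for n
    using int1 int2 by (subst Bochner_Integration.integral_diff[symmetric]) (auto simp: algebra_simps)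
  ultimately show ?thesis by simp
qed

lemma L2_tendsto_norm2:
  fixes g :: "'a::euclidean_space \<Rightarrow> 'b::euclidean_space"
  assumes g: "g \<in> L2 \<Omega>" and gn: "\<And>n. gn n \<in> L2 \<Omega>"
    and conv: "(\<lambda>n. LINT x|lebesgue_on \<Omega>. (norm (g x - gn n x))\<^sup>2) \<longlonglongrightarrow> 0"
  shows "(\<lambda>n. LINT x|lebesgue_on \<Omega>. (norm (gn n x))\<^sup>2) \<longlonglongrightarrow> (LINT x|lebesgue_on \<Omega>. (norm (g x))\<^sup>2)"
proof -
  let ?M = "lebesgue_on \<Omega>"
  have "(\<lambda>n. LINT x|?M. 1 * (g x \<bullet> gn n x)) \<longlonglongrightarrow> (LINT x|?M. 1 * (g x \<bullet> g x))"
    by (rule L2_tendsto_integral[OF g g gn conv, where C=1]) auto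
  then have "(\<lambda>n. (LINT x|?M. (norm (g x - gn n x))\<^sup>2) - (LINT x|?M. (norm (g x))\<^sup>2) + 2 * (LINT x|?M. g x \<bullet> gn n x))
      \<longlonglongrightarrow> 0 - (LINT x|?M. (norm (g x))\<^sup>2) + 2 * (LINT x|?M. (norm (g x))\<^sup>2)"
    by (intro tendsto_intros conv) (simp add: power2_norm_eq_inner)
  moreover have "(LINT x|?M. (norm (g x - gn n x))\<^sup>2) - (LINT x|?M. (norm (g x))\<^sup>2) + 2 * (LINT x|?M. g x \<bullet> gn n x)
      = (LINT x|?M. (norm (gn n x))\<^sup>2)" for n
  proof -
    have "integrable ?M (\<lambda>x. g x \<bullet> gn n x)"
      by (rule Bochner_Integration.integrable_bound[OF L2_integrable_mult[OF g gn[of n]]])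
        (use L2_measurable[OF g] L2_measurable[OF gn] in \<open>auto simp: Cauchy_Schwarz_ineq2 abs_mult\<close>)
    then have "(LINT x|?M. (norm (g x - gn n x))\<^sup>2) - (LINT x|?M. (norm (g x))\<^sup>2) + 2 * (LINT x|?M. g x \<bullet> gn n x)
       = (LINT x|?M. (norm (g x - gn n x))\<^sup>2 - (norm (g x))\<^sup>2 + 2 * (g x \<bullet> gn n x))"
      using L2_integrable[OF g] L2_integrable[OF L2_diff[OF g gn]] by simp
    also have "\<dots> = (LINT x|?M. (norm (gn n x))\<^sup>2)"
      by (intro Bochner_Integration.integral_cong) (auto simp: power2_norm_eq_inner algebra_simps inner_commute)
    finally show ?thesis .
  qed
  ultimately show ?thesis by simp
qed

text \<open>
  The convergence of test functions to an element of \<open>H\<^sub>0\<^sup>1(\<Omega>)\<close> that is used below. Convergence almost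
  everywhere, available after passing to a subsequence, is what nonlinear functions of the
  approximations need.
\<close>

definition H10_approximates ::
    "'a::euclidean_space set \<Rightarrow> ('a \<Rightarrow> real) \<Rightarrow> ('a \<Rightarrow> 'a) \<Rightarrow> (nat \<Rightarrow> 'a \<Rightarrow> real) \<Rightarrow> bool" where
  "H10_approximates \<Omega> u Du \<phi> \<longleftrightarrow>
     L2_weak_gradient \<Omega> u Du \<and> (\<forall>n. \<phi> n \<in> test_functions \<Omega>) \<and>
     (\<lambda>n. LINT x|lebesgue_on \<Omega>. (norm (u x - \<phi> n x))\<^sup>2) \<longlonglongrightarrow> 0 \<and>
     (\<lambda>n. LINT x|lebesgue_on \<Omega>. (norm (Du x - gradient (\<phi> n) x))\<^sup>2) \<longlonglongrightarrow> 0 \<and>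
     (AE x in lebesgue_on \<Omega>. (\<lambda>n. \<phi> n x) \<longlonglongrightarrow> u x)"

lemma H10_approximation:
  fixes u :: "'a::euclidean_space \<Rightarrow> real"
  assumes "u \<in> H10 \<Omega>" and \<Omega>: "\<Omega> \<in> sets lebesgue"
  obtains Du \<phi> where "H10_approximates \<Omega> u Du \<phi>"
proof -
  let ?M = "lebesgue_on \<Omega>"
  obtain Du \<phi> where wg: "L2_weak_gradient \<Omega> u Du" and test: "\<And>n::nat. \<phi> n \<in> test_functions \<Omega>"
    and lim: "(\<lambda>n. LINT x|?M. (u x - \<phi> n x)\<^sup>2 + (norm (Du x - gradient (\<phi> n) x))\<^sup>2) \<longlonglongrightarrow> 0"
    using assms(1) unfolding H10_def by blast
  have L2: "u \<in> L2 \<Omega>" "Du \<in> L2 \<Omega>" using wg by (auto simp: L2_weak_gradient_def)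
  note test_L2 = test_functions_L2[OF test \<Omega>]
  have int: "integrable ?M (\<lambda>x. (u x - \<phi> n x)\<^sup>2)" "integrable ?M (\<lambda>x. (norm (Du x - gradient (\<phi> n) x))\<^sup>2)" for n
    using L2_integrable[OF L2_diff[OF L2(1) test_L2(1)]] L2_integrable[OF L2_diff[OF L2(2) test_L2(2)]] by simp_all
  have lim1: "(\<lambda>n. LINT x|?M. (u x - \<phi> n x)\<^sup>2) \<longlonglongrightarrow> 0"
    by (rule tendsto_sandwich[OF _ _ tendsto_const lim]) (use int in \<open>auto intro!: always_eventually integral_mono\<close>)
  have lim2: "(\<lambda>n. LINT x|?M. (norm (Du x - gradient (\<phi> n) x))\<^sup>2) \<longlonglongrightarrow> 0"
    by (rule tendsto_sandwich[OF _ _ tendsto_const lim]) (use int in \<open>auto intro!: always_eventually integral_mono\<close>)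
  have "\<exists>r. strict_mono r \<and> (AE x in ?M. (\<lambda>n. (u x - \<phi> (r n) x)\<^sup>2) \<longlonglongrightarrow> 0)"
    using tendsto_L1_AE_subseq[of ?M "\<lambda>n x. (u x - \<phi> n x)\<^sup>2"] int(1) lim1 by simp
  then obtain r :: "nat \<Rightarrow> nat" where r: "strict_mono r" and AE: "AE x in ?M. (\<lambda>n. (u x - \<phi> (r n) x)\<^sup>2) \<longlonglongrightarrow> 0"
    by blast
  have "AE x in ?M. (\<lambda>n. \<phi> (r n) x) \<longlonglongrightarrow> u x"
    using AE
  proof eventually_elim
    case (elim x)
    then have "(\<lambda>n. u x - \<phi> (r n) x) \<longlonglongrightarrow> 0"
      using tendsto_real_sqrt[OF elim] tendsto_rabs_zero_iff by simp
    from tendsto_diff[OF tendsto_const[of "u x"] this] show ?case by simp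
  qed
  moreover have "(\<lambda>n. LINT x|?M. (norm (u x - \<phi> (r n) x))\<^sup>2) \<longlonglongrightarrow> 0"
    using LIMSEQ_subseq_LIMSEQ[OF lim1 r] by (simp add: o_def)
  moreover have "(\<lambda>n. LINT x|?M. (norm (Du x - gradient (\<phi> (r n)) x))\<^sup>2) \<longlonglongrightarrow> 0"
    using LIMSEQ_subseq_LIMSEQ[OF lim2 r] by (simp add: o_def)
  ultimately show thesis
    using wg test by (intro that[of Du "\<lambda>n. \<phi> (r n)"]) (simp add: H10_approximates_def)
qed

section \<open>Composite test functions in a weak equation\<close>

text \<open>
  A smooth positive regularisation of the absolute value. The approximations of a positive function
  may change sign; through this function they become positive and keep their limit.
\<close>

definition sqrt_reg :: "real \<Rightarrow> real \<Rightarrow> real" where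
  "sqrt_reg d s = (s\<^sup>2 + d) powr (1/2)"

lemma smooth_sqrt_reg:
  assumes "smooth u" "d > 0"
  shows "smooth (\<lambda>x. sqrt_reg d (u x))"
  unfolding sqrt_reg_def using assms
  by (intro smooth_powr smooth_add smooth_power2 smooth_const) (auto intro: add_nonneg_pos)

lemma sqrt_reg_eq: "d \<ge> 0 \<Longrightarrow> sqrt_reg d s = sqrt (s\<^sup>2 + d)"
  by (simp add: sqrt_reg_def powr_half_sqrt)

lemma sqrt_reg_pos: "d > 0 \<Longrightarrow> sqrt_reg d s > 0"
  by (simp add: sqrt_reg_eq add_nonneg_pos)

lemma has_derivative_sqrt_reg:
  assumes "(u has_derivative (\<lambda>h. g \<bullet> h)) (at x)" "d > 0"
  shows "((\<lambda>x. sqrt_reg d (u x)) has_derivative (\<lambda>h. ((u x / sqrt_reg d (u x)) *\<^sub>R g) \<bullet> h)) (at x)"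
proof -
  have pos: "(u x)\<^sup>2 + d > 0" using assms(2) by (rule add_nonneg_pos[OF zero_le_power2])
  have "((\<lambda>x. (u x)\<^sup>2 + d) has_derivative (\<lambda>h. u x * (g \<bullet> h) + (g \<bullet> h) * u x)) (at x)"
    using has_derivative_add[OF has_derivative_mult[OF assms(1) assms(1)] has_derivative_const[of d]]
    by (simp add: power2_eq_square)
  from DERIV_compose_FDERIV[where f=sqrt and g="\<lambda>x. (u x)\<^sup>2 + d", OF DERIV_real_sqrt[OF pos] this]
  have "((\<lambda>x. sqrt ((u x)\<^sup>2 + d)) has_derivative (\<lambda>h. (u x / sqrt ((u x)\<^sup>2 + d)) * (g \<bullet> h))) (at x)"
    by (rule has_derivative_eq_rhs) (rule ext, simp add: divide_simps)
  then show ?thesis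
    using assms(2) by (simp add: sqrt_reg_eq)
qed

lemma sqrt_reg_ratio_le_1:
  assumes "d > 0"
  shows "\<bar>s / sqrt_reg d s\<bar> \<le> 1"
proof -
  have "\<bar>s\<bar> \<le> sqrt_reg d s"
    using real_sqrt_le_mono[of "s\<^sup>2" "s\<^sup>2 + d"] assms by (simp add: sqrt_reg_eq)
  then show ?thesis
    using sqrt_reg_pos[OF assms, of s] by (simp add: abs_divide)
qed

lemma sqrt_reg_tendsto:
  assumes "u \<longlonglongrightarrow> l" "d \<longlonglongrightarrow> 0" "\<And>n. d n > 0" "l > 0"
  shows "(\<lambda>n. sqrt_reg (d n) (u n)) \<longlonglongrightarrow> l"
proof -
  have "(\<lambda>n. sqrt ((u n)\<^sup>2 + d n)) \<longlonglongrightarrow> sqrt (l\<^sup>2 + 0)"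
    by (intro tendsto_intros assms)
  then show ?thesis using assms(3,4) by (simp add: sqrt_reg_eq less_imp_le)
qed

lemma LIMSEQ_inverse_Suc: "(\<lambda>n. 1 / real (Suc n)) \<longlonglongrightarrow> 0"
  by (rule LIMSEQ_Suc[OF lim_1_over_n])

text \<open>
  The weak equation may be tested with \<open>\<phi>\<^sup>2 F(u + \<epsilon>, v + \<epsilon>)\<close>, where the gradient of the test function is
  given by the chain rule and \<open>F\<close> is smooth and, with its first derivatives \<open>F1\<close> and \<open>F2\<close>, bounded
  on \<open>{s \<ge> \<epsilon>, t \<ge> \<epsilon>}\<close>. The proof tests with \<open>\<phi>\<^sup>2 F(U\<^sub>n, V\<^sub>n)\<close> for smooth \<open>U\<^sub>n, V\<^sub>n \<ge> \<epsilon>\<close> converging to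
  \<open>u + \<epsilon>\<close> and \<open>v + \<epsilon>\<close>; these are genuine test functions, and the limit is taken in the equation
  itself. On the side of \<open>f\<close> the functions \<open>f \<phi>\<^sup>2 F(U\<^sub>n, V\<^sub>n)\<close> are dominated by a multiple of
  \<open>\<bar>f \<phi>\<^sup>2\<bar>\<close>, which is integrable because \<open>\<phi>\<^sup>2\<close> is itself an admissible test function.
\<close>

lemma weak_poisson_test_composite:
  fixes u v f :: "'a::euclidean_space \<Rightarrow> real" and F F1 F2 :: "real \<Rightarrow> real \<Rightarrow> real"
  assumes \<Omega>: "\<Omega> \<in> sets lebesgue" and sol: "weak_poisson_solution \<Omega> f u"
    and apu: "H10_approximates \<Omega> u Du un" and apv: "H10_approximates \<Omega> v Dv vn"
    and upos: "AE x in lebesgue_on \<Omega>. u x > 0" and vpos: "AE x in lebesgue_on \<Omega>. v x > 0"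
    and \<phi>: "\<phi> \<in> test_functions \<Omega>" and \<epsilon>: "\<epsilon> > 0"
    and F_smooth: "\<And>U V :: 'a \<Rightarrow> real. smooth U \<Longrightarrow> smooth V \<Longrightarrow> (\<And>x. U x > 0) \<Longrightarrow> (\<And>x. V x > 0) \<Longrightarrow>
      smooth (\<lambda>x. F (U x) (V x))"
    and F_deriv: "\<And>s t. s > 0 \<Longrightarrow> t > 0 \<Longrightarrow>
      ((\<lambda>p. F (fst p) (snd p)) has_derivative (\<lambda>h. F1 s t * fst h + F2 s t * snd h)) (at (s, t))"
    and F1_cont: "\<And>s t. s > 0 \<Longrightarrow> t > 0 \<Longrightarrow> isCont (\<lambda>p. F1 (fst p) (snd p)) (s, t)"
    and F2_cont: "\<And>s t. s > 0 \<Longrightarrow> t > 0 \<Longrightarrow> isCont (\<lambda>p. F2 (fst p) (snd p)) (s, t)"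
    and F_meas: "(\<lambda>p. F (fst p) (snd p)) \<in> borel_measurable (borel \<Otimes>\<^sub>M borel)"
      "(\<lambda>p. F1 (fst p) (snd p)) \<in> borel_measurable (borel \<Otimes>\<^sub>M borel)"
      "(\<lambda>p. F2 (fst p) (snd p)) \<in> borel_measurable (borel \<Otimes>\<^sub>M borel)"
    and F_bound: "\<And>s t. s \<ge> \<epsilon> \<Longrightarrow> t \<ge> \<epsilon> \<Longrightarrow> \<bar>F s t\<bar> \<le> C"
      "\<And>s t. s \<ge> \<epsilon> \<Longrightarrow> t \<ge> \<epsilon> \<Longrightarrow> \<bar>F1 s t\<bar> \<le> C"
      "\<And>s t. s \<ge> \<epsilon> \<Longrightarrow> t \<ge> \<epsilon> \<Longrightarrow> \<bar>F2 s t\<bar> \<le> C"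
  defines "G \<equiv> \<lambda>x. 2 * \<phi> x * F (u x + \<epsilon>) (v x + \<epsilon>) * (Du x \<bullet> gradient \<phi> x)
      + (\<phi> x)\<^sup>2 * F1 (u x + \<epsilon>) (v x + \<epsilon>) * (Du x \<bullet> Du x)
      + (\<phi> x)\<^sup>2 * F2 (u x + \<epsilon>) (v x + \<epsilon>) * (Du x \<bullet> Dv x)"
  shows "integrable (lebesgue_on \<Omega>) G"
    and "has_bochner_integral (lebesgue_on \<Omega>) (\<lambda>x. f x * ((\<phi> x)\<^sup>2 * F (u x + \<epsilon>) (v x + \<epsilon>)))
      (LINT x|lebesgue_on \<Omega>. G x)"
proof -
  let ?M = "lebesgue_on \<Omega>"
  have wgu: "L2_weak_gradient \<Omega> u Du" and un: "\<And>n. un n \<in> test_functions \<Omega>"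
    and un_lim: "(\<lambda>n. LINT x|?M. (norm (Du x - gradient (un n) x))\<^sup>2) \<longlonglongrightarrow> 0"
    and un_AE: "AE x in ?M. (\<lambda>n. un n x) \<longlonglongrightarrow> u x"
    using apu by (auto simp: H10_approximates_def)
  have wgv: "L2_weak_gradient \<Omega> v Dv" and vn: "\<And>n. vn n \<in> test_functions \<Omega>"
    and vn_lim: "(\<lambda>n. LINT x|?M. (norm (Dv x - gradient (vn n) x))\<^sup>2) \<longlonglongrightarrow> 0"
    and vn_AE: "AE x in ?M. (\<lambda>n. vn n x) \<longlonglongrightarrow> v x"
    using apv by (auto simp: H10_approximates_def)
  have L2: "u \<in> L2 \<Omega>" "Du \<in> L2 \<Omega>" "v \<in> L2 \<Omega>" "Dv \<in> L2 \<Omega>"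
    using wgu wgv by (auto simp: L2_weak_gradient_def)
  note sm = test_functions_smooth[OF \<phi>] test_functions_smooth[OF un] test_functions_smooth[OF vn]
  note [measurable] = L2[THEN L2_measurable] sm[THEN smooth_measurable_lebesgue_on(1)[OF _ \<Omega>]]
    sm[THEN smooth_measurable_lebesgue_on(2)[OF _ \<Omega>]]
  obtain K where K: "K > 0" "\<And>x. \<bar>\<phi> x\<bar> \<le> K" using test_functions_bounded[OF \<phi>] by metis
  have C: "C \<ge> 0" using F_bound(1)[of \<epsilon> \<epsilon>] by simp
  define d where "d = (\<lambda>n. 1 / real (Suc n))"
  have d: "d n > 0" "d \<longlonglongrightarrow> 0" for n
    using LIMSEQ_inverse_Suc by (auto simp: d_def)
  define U where "U = (\<lambda>n x. sqrt_reg (d n) (un n x) + \<epsilon>)"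
  define V where "V = (\<lambda>n x. sqrt_reg (d n) (vn n x) + \<epsilon>)"
  define r where "r = (\<lambda>n x. un n x / sqrt_reg (d n) (un n x))"
  define s where "s = (\<lambda>n x. vn n x / sqrt_reg (d n) (vn n x))"
  have UV_ge: "U n x \<ge> \<epsilon>" "V n x \<ge> \<epsilon>" for n x
    using sqrt_reg_pos[OF d(1)] by (auto simp: U_def V_def less_imp_le)
  have UV_pos: "U n x > 0" "V n x > 0" for n x
    using UV_ge[of n x] \<epsilon> by linarith+
  have UV_smooth: "smooth (U n)" "smooth (V n)" for n
    unfolding U_def V_def by (intro smooth_add smooth_sqrt_reg smooth_const sm d)+
  have U_grad: "(U n has_derivative (\<lambda>h. (r n x *\<^sub>R gradient (un n) x) \<bullet> h)) (at x)" for n x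
    using has_derivative_add[OF has_derivative_sqrt_reg[OF has_derivative_gradient[OF sm(2)] d(1)] has_derivative_const[of \<epsilon>]]
    unfolding U_def r_def by simp
  have V_grad: "(V n has_derivative (\<lambda>h. (s n x *\<^sub>R gradient (vn n) x) \<bullet> h)) (at x)" for n x
    using has_derivative_add[OF has_derivative_sqrt_reg[OF has_derivative_gradient[OF sm(3)] d(1)] has_derivative_const[of \<epsilon>]]
    unfolding V_def s_def by simp
  have UV_lim: "AE x in ?M. u x > 0 \<and> v x > 0 \<and> (\<lambda>n. U n x) \<longlonglongrightarrow> u x + \<epsilon> \<and> (\<lambda>n. V n x) \<longlonglongrightarrow> v x + \<epsilon>
      \<and> (\<lambda>n. r n x) \<longlonglongrightarrow> 1 \<and> (\<lambda>n. s n x) \<longlonglongrightarrow> 1"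
    using un_AE vn_AE upos vpos
  proof eventually_elim
    case (elim x)
    have a: "(\<lambda>n. sqrt_reg (d n) (un n x)) \<longlonglongrightarrow> u x" "(\<lambda>n. sqrt_reg (d n) (vn n x)) \<longlonglongrightarrow> v x"
      using elim d by (auto intro!: sqrt_reg_tendsto)
    have "(\<lambda>n. U n x) \<longlonglongrightarrow> u x + \<epsilon>" "(\<lambda>n. V n x) \<longlonglongrightarrow> v x + \<epsilon>"
      unfolding U_def V_def using a by (auto intro!: tendsto_intros)
    moreover have "(\<lambda>n. r n x) \<longlonglongrightarrow> u x / u x"
      unfolding r_def by (rule tendsto_divide[OF elim(1) a(1)]) (use elim in simp)
    moreover have "(\<lambda>n. s n x) \<longlonglongrightarrow> v x / v x"
      unfolding s_def by (rule tendsto_divide[OF elim(2) a(2)]) (use elim in simp)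
    ultimately show ?case using elim by simp
  qed
  have F_cont: "isCont (\<lambda>p. F (fst p) (snd p)) (a, b)" if "a > 0" "b > 0" for a b
    using F_deriv[OF that] by (rule has_derivative_continuous)
  have comp: "(\<lambda>n. H (U n x) (V n x)) \<longlonglongrightarrow> H (u x + \<epsilon>) (v x + \<epsilon>)"
    if "u x > 0" "v x > 0" "(\<lambda>n. U n x) \<longlonglongrightarrow> u x + \<epsilon>" "(\<lambda>n. V n x) \<longlonglongrightarrow> v x + \<epsilon>"
      and H: "\<And>s t. s > 0 \<Longrightarrow> t > 0 \<Longrightarrow> isCont (\<lambda>p. H (fst p) (snd p)) (s, t)" for x and H :: "real \<Rightarrow> real \<Rightarrow> real"
    using isCont_tendsto_compose[OF H[of "u x + \<epsilon>" "v x + \<epsilon>"] tendsto_Pair[OF that(3,4)]] that(1,2) \<epsilon> by simp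
  have comp_meas: "(\<lambda>x. H (a x) (b x)) \<in> borel_measurable ?M"
    if "(\<lambda>p. H (fst p) (snd p)) \<in> borel_measurable (borel \<Otimes>\<^sub>M borel)" "a \<in> borel_measurable ?M" "b \<in> borel_measurable ?M"
    for H :: "real \<Rightarrow> real \<Rightarrow> real" and a b
    using measurable_compose[OF measurable_Pair[OF that(2,3)] that(1)] by simp
  have UV_meas [measurable]: "U n \<in> borel_measurable ?M" "V n \<in> borel_measurable ?M"
      "r n \<in> borel_measurable ?M" "s n \<in> borel_measurable ?M" for n
    unfolding U_def V_def r_def s_def sqrt_reg_def by measurable
  have uv_meas: "(\<lambda>x. u x + \<epsilon>) \<in> borel_measurable ?M" "(\<lambda>x. v x + \<epsilon>) \<in> borel_measurable ?M"
    by measurable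
  note [measurable] = F_meas[THEN comp_meas, OF UV_meas(1,2)] F_meas[THEN comp_meas, OF uv_meas]
  define \<psi> where "\<psi> = (\<lambda>n x. \<phi> x * (\<phi> x * F (U n x) (V n x)))"
  have \<psi>_test: "\<psi> n \<in> test_functions \<Omega>" for n
    unfolding \<psi>_def by (intro test_functions_mult \<phi> smooth_mult sm F_smooth UV_smooth UV_pos)
  define gn where "gn = (\<lambda>n x. (2 * \<phi> x * F (U n x) (V n x)) *\<^sub>R gradient \<phi> x
      + ((\<phi> x)\<^sup>2 * F1 (U n x) (V n x) * r n x) *\<^sub>R gradient (un n) x
      + ((\<phi> x)\<^sup>2 * F2 (U n x) (V n x) * s n x) *\<^sub>R gradient (vn n) x)"
  have \<psi>_grad: "gradient (\<psi> n) x = gn n x" for n x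
  proof (rule gradient_eqI)
    have "((\<lambda>x. F (U n x) (V n x)) has_derivative (\<lambda>h. F1 (U n x) (V n x) * ((r n x *\<^sub>R gradient (un n) x) \<bullet> h)
        + F2 (U n x) (V n x) * ((s n x *\<^sub>R gradient (vn n) x) \<bullet> h))) (at x)"
      using has_derivative_compose[OF has_derivative_Pair[OF U_grad[of n x] V_grad[of n x]] F_deriv[OF UV_pos]] by simp
    from has_derivative_mult[OF has_derivative_gradient[OF sm(1)] has_derivative_mult[OF has_derivative_gradient[OF sm(1)] this]]
    show "(\<psi> n has_derivative (\<lambda>h. gn n x \<bullet> h)) (at x)"
      unfolding \<psi>_def gn_def
      by (rule has_derivative_eq_rhs) (simp add: fun_eq_iff inner_add_left algebra_simps power2_eq_square)
  qed
  \<comment> \<open>The coefficients of the three gradients in \<open>gn\<close>, and their almost everywhere limits.\<close>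
  let ?k1 = "\<lambda>n x. 2 * \<phi> x * F (U n x) (V n x)"
  let ?k2 = "\<lambda>n x. (\<phi> x)\<^sup>2 * F1 (U n x) (V n x) * r n x"
  let ?k3 = "\<lambda>n x. (\<phi> x)\<^sup>2 * F2 (U n x) (V n x) * s n x"
  let ?l1 = "\<lambda>x. 2 * \<phi> x * F (u x + \<epsilon>) (v x + \<epsilon>)"
  let ?l2 = "\<lambda>x. (\<phi> x)\<^sup>2 * F1 (u x + \<epsilon>) (v x + \<epsilon>)"
  let ?l3 = "\<lambda>x. (\<phi> x)\<^sup>2 * F2 (u x + \<epsilon>) (v x + \<epsilon>)"
  have b1: "\<bar>?k1 n x\<bar> \<le> 2 * K * C" for n x
    unfolding abs_mult using K UV_ge[of n x] F_bound(1) by (intro mult_mono) auto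
  have \<phi>2: "\<bar>(\<phi> x)\<^sup>2\<bar> \<le> K\<^sup>2" for x
    using K power_mono[of "\<bar>\<phi> x\<bar>" K 2] by simp
  have b2: "\<bar>?k2 n x\<bar> \<le> K\<^sup>2 * C * 1" for n x
    unfolding abs_mult using \<phi>2[of x] C UV_ge[of n x] F_bound(2) sqrt_reg_ratio_le_1[OF d(1)]
    by (intro mult_mono) (auto simp: r_def abs_mult)
  have b3: "\<bar>?k3 n x\<bar> \<le> K\<^sup>2 * C * 1" for n x
    unfolding abs_mult using \<phi>2[of x] C UV_ge[of n x] F_bound(3) sqrt_reg_ratio_le_1[OF d(1)]
    by (intro mult_mono) (auto simp: s_def abs_mult)
  have k1: "AE x in ?M. (\<lambda>n. ?k1 n x) \<longlonglongrightarrow> ?l1 x"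
    using UV_lim
  proof eventually_elim
    case (elim x)
    show ?case by (intro tendsto_mult tendsto_const comp[of x F] F_cont) (use elim in auto)
  qed
  have k2: "AE x in ?M. (\<lambda>n. ?k2 n x) \<longlonglongrightarrow> ?l2 x"
    using UV_lim
  proof eventually_elim
    case (elim x)
    have "(\<lambda>n. ?k2 n x) \<longlonglongrightarrow> ?l2 x * 1"
      by (intro tendsto_mult tendsto_const comp[of x F1] F1_cont) (use elim in auto)
    then show ?case by simp
  qed
  have k3: "AE x in ?M. (\<lambda>n. ?k3 n x) \<longlonglongrightarrow> ?l3 x"
    using UV_lim
  proof eventually_elim
    case (elim x)
    have "(\<lambda>n. ?k3 n x) \<longlonglongrightarrow> ?l3 x * 1"
      by (intro tendsto_mult tendsto_const comp[of x F2] F2_cont) (use elim in auto)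
    then show ?case by simp
  qed
  have kint: "integrable ?M (\<lambda>x. k x * (h x \<bullet> g x))"
    if "h \<in> L2 \<Omega>" "g \<in> L2 \<Omega>" "k \<in> borel_measurable ?M" "AE x in ?M. \<bar>k x\<bar> \<le> B" for k B and h g :: "'a \<Rightarrow> 'a"
  proof (rule Bochner_Integration.integrable_bound)
    show "integrable ?M (\<lambda>x. \<bar>B\<bar> * (norm (h x) * norm (g x)))"
      using L2_integrable_mult[OF that(1,2)] by simp
    show "AE x in ?M. norm (k x * (h x \<bullet> g x)) \<le> norm (\<bar>B\<bar> * (norm (h x) * norm (g x)))"
      using that(4) by eventually_elim (auto simp: abs_mult intro!: mult_mono Cauchy_Schwarz_ineq2)
    show "(\<lambda>x. k x * (h x \<bullet> g x)) \<in> borel_measurable ?M"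
      using that(1,2)[THEN L2_measurable] that(3) by measurable
  qed
  note grad_L2 = test_functions_L2(2)[OF \<phi> \<Omega>] test_functions_L2(2)[OF un \<Omega>] test_functions_L2(2)[OF vn \<Omega>]
  have lim_bound: "AE x in ?M. \<bar>l x\<bar> \<le> B" if "AE x in ?M. (\<lambda>n. k n x) \<longlonglongrightarrow> l x" "\<And>n x. \<bar>k n x\<bar> \<le> B"
    for k :: "nat \<Rightarrow> 'a \<Rightarrow> real" and l B
    using that(1)
  proof eventually_elim
    case (elim x)
    show ?case
      by (rule LIMSEQ_le_const2[OF tendsto_rabs[OF elim]]) (use that(2) in auto)
  qed
  have int_l: "integrable ?M (\<lambda>x. ?l1 x * (Du x \<bullet> gradient \<phi> x))" "integrable ?M (\<lambda>x. ?l2 x * (Du x \<bullet> Du x))"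
      "integrable ?M (\<lambda>x. ?l3 x * (Du x \<bullet> Dv x))"
    by (rule kint[OF L2(2) grad_L2(1) _ lim_bound[OF k1 b1]], measurable,
        rule kint[OF L2(2) L2(2) _ lim_bound[OF k2 b2]], measurable,
        rule kint[OF L2(2) L2(4) _ lim_bound[OF k3 b3]], measurable)
  show G_int: "integrable ?M G"
    unfolding G_def by (intro Bochner_Integration.integrable_add int_l)
  have int_k: "integrable ?M (\<lambda>x. ?k1 n x * (Du x \<bullet> gradient \<phi> x))" "integrable ?M (\<lambda>x. ?k2 n x * (Du x \<bullet> gradient (un n) x))"
      "integrable ?M (\<lambda>x. ?k3 n x * (Du x \<bullet> gradient (vn n) x))" for n
    by (rule kint[OF L2(2) grad_L2(1) _ AE_I2[OF b1]], measurable,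
        rule kint[OF L2(2) grad_L2(2) _ AE_I2[OF b2]], measurable,
        rule kint[OF L2(2) grad_L2(3) _ AE_I2[OF b3]], measurable)
  have "(\<lambda>n. (LINT x|?M. ?k1 n x * (Du x \<bullet> gradient \<phi> x)) + (LINT x|?M. ?k2 n x * (Du x \<bullet> gradient (un n) x))
        + (LINT x|?M. ?k3 n x * (Du x \<bullet> gradient (vn n) x)))
      \<longlonglongrightarrow> (LINT x|?M. ?l1 x * (Du x \<bullet> gradient \<phi> x)) + (LINT x|?M. ?l2 x * (Du x \<bullet> Du x))
        + (LINT x|?M. ?l3 x * (Du x \<bullet> Dv x))"
  proof (intro tendsto_add)
    show "(\<lambda>n. LINT x|?M. ?k1 n x * (Du x \<bullet> gradient \<phi> x)) \<longlonglongrightarrow> (LINT x|?M. ?l1 x * (Du x \<bullet> gradient \<phi> x))"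
      by (rule L2_tendsto_integral[OF L2(2) grad_L2(1) grad_L2(1) _ _ _ b1 k1]) (simp, measurable)
    show "(\<lambda>n. LINT x|?M. ?k2 n x * (Du x \<bullet> gradient (un n) x)) \<longlonglongrightarrow> (LINT x|?M. ?l2 x * (Du x \<bullet> Du x))"
      by (rule L2_tendsto_integral[OF L2(2) L2(2) grad_L2(2) un_lim _ _ b2 k2]) measurable
    show "(\<lambda>n. LINT x|?M. ?k3 n x * (Du x \<bullet> gradient (vn n) x)) \<longlonglongrightarrow> (LINT x|?M. ?l3 x * (Du x \<bullet> Dv x))"
      by (rule L2_tendsto_integral[OF L2(2) L2(4) grad_L2(3) vn_lim _ _ b3 k3]) measurable
  qed
  also have "(\<lambda>n. (LINT x|?M. ?k1 n x * (Du x \<bullet> gradient \<phi> x)) + (LINT x|?M. ?k2 n x * (Du x \<bullet> gradient (un n) x))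
        + (LINT x|?M. ?k3 n x * (Du x \<bullet> gradient (vn n) x))) = (\<lambda>n. LINT x|?M. Du x \<bullet> gradient (\<psi> n) x)"
    using int_k by (simp add: fun_eq_iff \<psi>_grad gn_def inner_add_right)
  also have "(LINT x|?M. ?l1 x * (Du x \<bullet> gradient \<phi> x)) + (LINT x|?M. ?l2 x * (Du x \<bullet> Du x))
        + (LINT x|?M. ?l3 x * (Du x \<bullet> Dv x)) = (LINT x|?M. G x)"
    unfolding G_def using int_l by simp
  finally have rhs: "(\<lambda>n. LINT x|?M. Du x \<bullet> gradient (\<psi> n) x) \<longlonglongrightarrow> (LINT x|?M. G x)" .
  have test: "has_bochner_integral ?M (\<lambda>x. f x * \<eta> x) (LINT x|?M. Du x \<bullet> gradient \<eta> x)"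
    if "\<eta> \<in> test_functions \<Omega>" for \<eta>
    using sol wgu test_functions_H10[OF that \<Omega>] test_functions_weak_gradient[OF that \<Omega>]
    unfolding weak_poisson_solution_def by blast
  have f\<phi>: "integrable ?M (\<lambda>x. f x * (\<phi> x)\<^sup>2)"
    unfolding power2_eq_square by (rule integrable.intros[OF test[OF test_functions_mult[OF \<phi> sm(1)]]])
  have [measurable]: "(\<lambda>x. f x * (\<phi> x)\<^sup>2) \<in> borel_measurable ?M"
    using f\<phi> by (rule borel_measurable_integrable)
  let ?L = "\<lambda>x. f x * ((\<phi> x)\<^sup>2 * F (u x + \<epsilon>) (v x + \<epsilon>))"
  have L_eq: "?L = (\<lambda>x. (f x * (\<phi> x)\<^sup>2) * F (u x + \<epsilon>) (v x + \<epsilon>))"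
    by (simp add: mult.assoc)
  have \<psi>_eq: "(\<lambda>x. f x * \<psi> n x) = (\<lambda>x. (f x * (\<phi> x)\<^sup>2) * F (U n x) (V n x))" for n
    by (simp add: \<psi>_def power2_eq_square mult.assoc)
  have dom: "integrable ?M (\<lambda>x. \<bar>f x * (\<phi> x)\<^sup>2\<bar> * C)" using f\<phi> by simp
  have AE1: "AE x in ?M. (\<lambda>n. f x * \<psi> n x) \<longlonglongrightarrow> ?L x"
    using UV_lim unfolding fun_cong[OF \<psi>_eq] fun_cong[OF L_eq]
  proof eventually_elim
    case (elim x)
    show ?case by (intro tendsto_mult tendsto_const comp[of x F] F_cont) (use elim in auto)
  qed
  have AE2: "AE x in ?M. norm (f x * \<psi> n x) \<le> \<bar>f x * (\<phi> x)\<^sup>2\<bar> * C" for n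
    unfolding fun_cong[OF \<psi>_eq] norm_mult real_norm_def abs_mult
    by (intro AE_I2 mult_left_mono F_bound UV_ge) simp
  have meas: "?L \<in> borel_measurable ?M" "\<And>n. (\<lambda>x. f x * \<psi> n x) \<in> borel_measurable ?M"
    unfolding L_eq \<psi>_eq by measurable
  have "(\<lambda>n. LINT x|?M. f x * \<psi> n x) \<longlonglongrightarrow> (LINT x|?M. ?L x)"
    by (rule integral_dominated_convergence[OF meas dom AE1 AE2])
  moreover have "(LINT x|?M. f x * \<psi> n x) = (LINT x|?M. Du x \<bullet> gradient (\<psi> n) x)" for n
    by (rule has_bochner_integral_integral_eq[OF test[OF \<psi>_test]])
  ultimately have "(LINT x|?M. ?L x) = (LINT x|?M. G x)"
    using rhs LIMSEQ_unique by simp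
  moreover have "integrable ?M ?L"
    by (rule integrable_dominated_convergence[OF meas dom AE1 AE2])
  ultimately show "has_bochner_integral ?M ?L (LINT x|?M. G x)"
    by (simp add: has_bochner_integral_iff)
qed

section \<open>The weights\<close>

text \<open>
  With \<open>w(s, t) = (s\<^bsup>-q\<^esup> + t\<^bsup>-q\<^esup>)\<^bsup>-1/q\<^esup>\<close>, a smooth concave substitute for the minimum of \<open>s\<close> and \<open>t\<close>, the
  partial derivative of \<open>ln w\<close> in \<open>s\<close> is \<open>weight q s t / s\<close>, and the one in \<open>t\<close> is
  \<open>weight q t s / t\<close>.
\<close>

definition weight :: "real \<Rightarrow> real \<Rightarrow> real \<Rightarrow> real" where
  "weight q s t = t powr q / (s powr q + t powr q)"

lemma add_powr_pos: "s > 0 \<Longrightarrow> (0::real) < s powr q + t powr q"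
  by (rule add_pos_nonneg) simp_all

lemma weight_bounds:
  assumes "s > 0" "t > 0"
  shows "weight q s t \<ge> 0" "weight q s t \<le> 1"
  using add_powr_pos[OF assms(1), of q t] by (simp_all add: weight_def divide_le_eq)

lemma weight_swap:
  assumes "s > 0" "t > 0"
  shows "weight q t s = 1 - weight q s t"
  using add_powr_pos[OF assms(1), of q t] by (simp add: weight_def field_simps)

definition test_factor :: "real \<Rightarrow> real \<Rightarrow> real \<Rightarrow> real" where
  "test_factor q s t = weight q s t / s"

definition test_factor_d1 :: "real \<Rightarrow> real \<Rightarrow> real \<Rightarrow> real" where
  "test_factor_d1 q s t = - (weight q s t + q * weight q s t * weight q t s) / s\<^sup>2"

definition test_factor_d2 :: "real \<Rightarrow> real \<Rightarrow> real \<Rightarrow> real" where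
  "test_factor_d2 q s t = q * weight q s t * weight q t s / (s * t)"

lemma test_factor_smooth:
  assumes "smooth U" "smooth V" "\<And>x. U x > 0" "\<And>x. V x > 0"
  shows "smooth (\<lambda>x. test_factor q (U x) (V x))"
proof -
  have "smooth (\<lambda>x. V x powr q * (U x * (U x powr q + V x powr q)) powr (-1))"
    using assms by (intro smooth_mult smooth_powr smooth_add mult_pos_pos add_powr_pos)
  moreover have "V x powr q * (U x * (U x powr q + V x powr q)) powr (-1) = test_factor q (U x) (V x)" for x
  proof -
    have "U x * (U x powr q + V x powr q) > 0"
      using assms(3)[of x] by (intro mult_pos_pos add_powr_pos)
    then show ?thesis
      by (simp add: test_factor_def weight_def powr_minus_divide mult.commute)
  qed
  ultimately show ?thesis by simp
qed

text \<open>
  All derivatives are expressed through the two weights: only their values in \<open>[0,1]\<close> and the fact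
  that they sum to one matter later.
\<close>

lemma test_factor_has_derivative:
  assumes s: "s > 0" and t: "t > 0"
  shows "((\<lambda>p. test_factor q (fst p) (snd p)) has_derivative
    (\<lambda>h. test_factor_d1 q s t * fst h + test_factor_d2 q s t * snd h)) (at (s, t))"
proof -
  define A where "A = s powr q"
  define B where "B = t powr q"
  have pos: "A > 0" "B > 0" using s t by (simp_all add: A_def B_def)
  have powr1: "((\<lambda>p. fst p powr q) has_derivative (\<lambda>h. q * A / s * fst h)) (at (s, t))"
    using has_derivative_powr[OF has_derivative_fst[OF has_derivative_ident] has_derivative_const[of q], where x="(s,t)" and X=UNIV] s
    by (rule_tac has_derivative_eq_rhs) (auto simp: A_def field_simps)
  have powr2: "((\<lambda>p. snd p powr q) has_derivative (\<lambda>h. q * B / t * snd h)) (at (s, t))"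
    using has_derivative_powr[OF has_derivative_snd[OF has_derivative_ident] has_derivative_const[of q], where x="(s,t)" and X=UNIV] t
    by (rule_tac has_derivative_eq_rhs) (auto simp: B_def field_simps)
  have den: "((\<lambda>p. fst p * (fst p powr q + snd p powr q)) has_derivative
      (\<lambda>h. s * (q * A / s * fst h + q * B / t * snd h) + fst h * (A + B))) (at (s, t))"
    using has_derivative_mult[OF has_derivative_fst[OF has_derivative_ident] has_derivative_add[OF powr1 powr2]]
    by (simp add: A_def B_def)
  have "((\<lambda>p. snd p powr q / (fst p * (fst p powr q + snd p powr q))) has_derivative
      (\<lambda>h. (q * B / t * snd h * (s * (A + B)) - B * (s * (q * A / s * fst h + q * B / t * snd h) + fst h * (A + B)))
        / (s * (A + B) * (s * (A + B))))) (at (s, t))"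
    using has_derivative_divide'[OF powr2 den] s add_powr_pos[OF s, of q t] by (simp add: A_def B_def)
  moreover have "(q * B / t * k * (s * (A + B)) - B * (s * (q * A / s * h + q * B / t * k) + h * (A + B)))
        / (s * (A + B) * (s * (A + B))) = test_factor_d1 q s t * h + test_factor_d2 q s t * k" for h k
  proof -
    have sum: "A + B \<noteq> 0" using pos by simp
    have w: "weight q s t = B / (A + B)" "weight q t s = A / (A + B)"
      by (simp_all add: weight_def A_def B_def add.commute)
    show ?thesis
      unfolding test_factor_d1_def test_factor_d2_def w using s t sum
      by (simp add: divide_simps) algebra
  qed
  moreover have "(\<lambda>p. snd p powr q / (fst p * (fst p powr q + snd p powr q)))
      = (\<lambda>p. test_factor q (fst p) (snd p))"
    by (simp add: fun_eq_iff test_factor_def weight_def mult.commute)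
  ultimately show ?thesis by simp
qed

lemma weight_isCont:
  assumes "s > 0" "t > 0"
  shows "isCont (\<lambda>p. weight q (fst p) (snd p)) (s, t)" "isCont (\<lambda>p. weight q (snd p) (fst p)) (s, t)"
  unfolding weight_def using assms add_powr_pos[of s q t] add_powr_pos[of t q s]
  by (auto intro!: continuous_intros)

lemma test_factor_isCont:
  assumes "s > 0" "t > 0"
  shows "isCont (\<lambda>p. test_factor_d1 q (fst p) (snd p)) (s, t)"
    and "isCont (\<lambda>p. test_factor_d2 q (fst p) (snd p)) (s, t)"
  unfolding test_factor_d1_def test_factor_d2_def using assms
  by (auto intro!: continuous_intros weight_isCont)

lemma test_factor_measurable:
  "(\<lambda>p. test_factor q (fst p) (snd p)) \<in> borel_measurable (borel \<Otimes>\<^sub>M borel)"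
  "(\<lambda>p. test_factor_d1 q (fst p) (snd p)) \<in> borel_measurable (borel \<Otimes>\<^sub>M borel)"
  "(\<lambda>p. test_factor_d2 q (fst p) (snd p)) \<in> borel_measurable (borel \<Otimes>\<^sub>M borel)"
  unfolding test_factor_def test_factor_d1_def test_factor_d2_def weight_def by measurable

lemma test_factor_bounds:
  assumes \<epsilon>: "\<epsilon> > 0" and "s \<ge> \<epsilon>" "t \<ge> \<epsilon>" and q: "q > 0"
  defines "C \<equiv> 1 / \<epsilon> + (1 + q) / \<epsilon>\<^sup>2"
  shows "\<bar>test_factor q s t\<bar> \<le> C" "\<bar>test_factor_d1 q s t\<bar> \<le> C" "\<bar>test_factor_d2 q s t\<bar> \<le> C"
proof -
  have pos: "s > 0" "t > 0" using assms by auto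
  note w = weight_bounds[OF pos, of q] weight_bounds[OF pos(2,1), of q]
  have ww: "0 \<le> weight q s t * weight q t s" "weight q s t * weight q t s \<le> 1"
    using w by (auto intro: mult_nonneg_nonneg mult_le_one)
  have "\<bar>test_factor q s t\<bar> \<le> 1 / \<epsilon>"
    unfolding test_factor_def using w pos assms(2) \<epsilon> by (auto simp: abs_divide intro!: frac_le)
  then show "\<bar>test_factor q s t\<bar> \<le> C"
    using \<epsilon> q by (simp add: C_def add_increasing2)
  have qww: "0 \<le> q * weight q s t * weight q t s" "q * weight q s t * weight q t s \<le> q"
    using q ww mult_left_mono[OF ww(2), of q] by (simp_all add: mult.assoc)
  then have num: "\<bar>- (weight q s t + q * weight q s t * weight q t s)\<bar> \<le> 1 + q"
      "\<bar>q * weight q s t * weight q t s\<bar> \<le> 1 + q"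
    using w by linarith+
  have "\<bar>test_factor_d1 q s t\<bar> \<le> (1 + q) / \<epsilon>\<^sup>2"
    unfolding test_factor_d1_def abs_divide using num(1) pos assms(2) \<epsilon> q
    by (intro frac_le) (auto intro!: power_mono)
  then show "\<bar>test_factor_d1 q s t\<bar> \<le> C"
    using \<epsilon> by (simp add: C_def add_increasing)
  have "\<bar>test_factor_d2 q s t\<bar> \<le> (1 + q) / \<epsilon>\<^sup>2"
    unfolding test_factor_d2_def power2_eq_square abs_divide using num(2) pos assms(2,3) \<epsilon> q
    by (intro frac_le) (auto intro!: mult_mono simp: abs_mult)
  then show "\<bar>test_factor_d2 q s t\<bar> \<le> C"
    using \<epsilon> by (simp add: C_def add_increasing)
qed

lemma weak_poisson_test_weighted:
  fixes u v f :: "'a::euclidean_space \<Rightarrow> real"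
  assumes "\<Omega> \<in> sets lebesgue" "weak_poisson_solution \<Omega> f u"
    and "H10_approximates \<Omega> u Du un" "H10_approximates \<Omega> v Dv vn"
    and "AE x in lebesgue_on \<Omega>. u x > 0" "AE x in lebesgue_on \<Omega>. v x > 0"
    and "\<phi> \<in> test_functions \<Omega>" and \<epsilon>: "\<epsilon> > 0" and q: "q > 0"
  defines "G \<equiv> \<lambda>x. 2 * \<phi> x * test_factor q (u x + \<epsilon>) (v x + \<epsilon>) * (Du x \<bullet> gradient \<phi> x)
      + (\<phi> x)\<^sup>2 * test_factor_d1 q (u x + \<epsilon>) (v x + \<epsilon>) * (Du x \<bullet> Du x)
      + (\<phi> x)\<^sup>2 * test_factor_d2 q (u x + \<epsilon>) (v x + \<epsilon>) * (Du x \<bullet> Dv x)"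
  shows "integrable (lebesgue_on \<Omega>) G"
    and "has_bochner_integral (lebesgue_on \<Omega>) (\<lambda>x. f x * ((\<phi> x)\<^sup>2 * test_factor q (u x + \<epsilon>) (v x + \<epsilon>)))
      (LINT x|lebesgue_on \<Omega>. G x)"
proof -
  note composite = weak_poisson_test_composite[where F="test_factor q" and ?F1.0="test_factor_d1 q"
      and ?F2.0="test_factor_d2 q" and C="1 / \<epsilon> + (1 + q) / \<epsilon>\<^sup>2", OF assms(1-8)]
  show "integrable (lebesgue_on \<Omega>) G"
    unfolding G_def
    by (rule composite(1); (rule test_factor_smooth test_factor_has_derivative test_factor_isCont
          test_factor_measurable test_factor_bounds; (assumption | rule \<epsilon> q)))
  show "has_bochner_integral (lebesgue_on \<Omega>) (\<lambda>x. f x * ((\<phi> x)\<^sup>2 * test_factor q (u x + \<epsilon>) (v x + \<epsilon>)))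
      (LINT x|lebesgue_on \<Omega>. G x)"
    unfolding G_def
    by (rule composite(2); (rule test_factor_smooth test_factor_has_derivative test_factor_isCont
          test_factor_measurable test_factor_bounds; (assumption | rule \<epsilon> q)))
qed

section \<open>The pointwise inequalities\<close>

text \<open>
  Picone's inequality in pointwise form: for \<open>X = \<nabla>u / u\<close>, \<open>c = \<phi>\<close> and \<open>g = \<nabla>\<phi>\<close> the left-hand side is
  \<open>\<nabla>u \<bullet> \<nabla>(\<phi>\<^sup>2 / u)\<close>.
\<close>

lemma picone_inequality:
  fixes X g :: "'a::real_inner"
  shows "2 * c * (X \<bullet> g) - c\<^sup>2 * (X \<bullet> X) \<le> (norm g)\<^sup>2"
proof -
  have "0 \<le> (norm (g - c *\<^sub>R X))\<^sup>2" by simp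
  also have "\<dots> = (norm g)\<^sup>2 - 2 * c * (X \<bullet> g) + c\<^sup>2 * (X \<bullet> X)"
    by (simp add: power2_norm_eq_inner inner_diff_left inner_diff_right inner_commute[of g X])
      (simp add: power2_eq_square algebra_simps)
  finally show ?thesis by simp
qed

text \<open>
  With \<open>X = Du / s\<close>, \<open>Y = Dv / t\<close> and weights \<open>a + b = 1\<close>, the left-hand side is the average, with
  weights \<open>a\<close> and \<open>b\<close>, of the expressions in Picone's inequality for \<open>X\<close> and for \<open>Y\<close>, minus
  \<open>q a b c\<^sup>2 \<bar>X - Y\<bar>\<^sup>2\<close>. The last term comes from differentiating the weights and has the favourable sign
  because each weight favours the smaller of the two functions.
\<close>

lemma picone_inequality_pair:
  fixes Du Dv g :: "'a::real_inner"
  assumes s: "s > 0" and t: "t > 0" and q: "q > 0"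
  shows "(2 * c * test_factor q s t * (Du \<bullet> g) + c\<^sup>2 * test_factor_d1 q s t * (Du \<bullet> Du)
        + c\<^sup>2 * test_factor_d2 q s t * (Du \<bullet> Dv))
      + (2 * c * test_factor q t s * (Dv \<bullet> g) + c\<^sup>2 * test_factor_d1 q t s * (Dv \<bullet> Dv)
        + c\<^sup>2 * test_factor_d2 q t s * (Dv \<bullet> Du)) \<le> (norm g)\<^sup>2"
    (is "?L \<le> _")
proof -
  define X where "X = (1 / s) *\<^sub>R Du"
  define Y where "Y = (1 / t) *\<^sub>R Dv"
  define a where "a = weight q s t"
  define b where "b = weight q t s"
  have ab: "a \<ge> 0" "b \<ge> 0" "b = 1 - a"
    unfolding a_def b_def using weight_bounds[OF s t] weight_bounds[OF t s] weight_swap[OF s t] by blast+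
  have D: "Du = s *\<^sub>R X" "Dv = t *\<^sub>R Y" using s t by (simp_all add: X_def Y_def)
  have F: "test_factor q s t = a / s" "test_factor q t s = b / t"
    "test_factor_d1 q s t = - (a + q * a * b) / s\<^sup>2" "test_factor_d1 q t s = - (b + q * b * a) / t\<^sup>2"
    "test_factor_d2 q s t = q * a * b / (s * t)" "test_factor_d2 q t s = q * b * a / (t * s)"
    by (simp_all add: test_factor_def test_factor_d1_def test_factor_d2_def a_def b_def)
  have eqs: "2 * c * test_factor q s t * (Du \<bullet> g) = 2 * c * a * (X \<bullet> g)"
    "2 * c * test_factor q t s * (Dv \<bullet> g) = 2 * c * b * (Y \<bullet> g)"
    "c\<^sup>2 * test_factor_d1 q s t * (Du \<bullet> Du) = - (c\<^sup>2 * (a + q * a * b) * (X \<bullet> X))"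
    "c\<^sup>2 * test_factor_d1 q t s * (Dv \<bullet> Dv) = - (c\<^sup>2 * (b + q * b * a) * (Y \<bullet> Y))"
    "c\<^sup>2 * test_factor_d2 q s t * (Du \<bullet> Dv) = c\<^sup>2 * (q * a * b) * (X \<bullet> Y)"
    "c\<^sup>2 * test_factor_d2 q t s * (Dv \<bullet> Du) = c\<^sup>2 * (q * b * a) * (Y \<bullet> X)"
    unfolding F D using s t by (simp_all add: power2_eq_square field_simps)
  have "?L = a * (2 * c * (X \<bullet> g) - c\<^sup>2 * (X \<bullet> X)) + b * (2 * c * (Y \<bullet> g) - c\<^sup>2 * (Y \<bullet> Y))
      - q * a * b * c\<^sup>2 * ((X - Y) \<bullet> (X - Y))"
    unfolding eqs inner_diff_left inner_diff_right inner_commute[of Y X] by (simp add: algebra_simps)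
  also have "\<dots> \<le> a * (norm g)\<^sup>2 + b * (norm g)\<^sup>2 - 0"
    using ab(1,2) q by (intro diff_mono add_mono mult_left_mono picone_inequality) auto
  also have "\<dots> = (norm g)\<^sup>2" by (simp add: ab(3) algebra_simps)
  finally show ?thesis .
qed

text \<open>
  For \<open>\<epsilon> = 0\<close> the product is at most zero: up to a common positive factor the second difference is
  \<open>s\<^bsup>m-2-q\<^esup> - t\<^bsup>m-2-q\<^esup>\<close>, and \<open>q > m - 2\<close> gives it the sign opposite to that of \<open>s\<^bsup>m\<^esup> - t\<^bsup>m\<^esup>\<close>. For \<open>\<epsilon> > 0\<close>
  this persists as long as \<open>t \<ge> \<epsilon>\<close>. For \<open>t < \<epsilon>\<close> the exponent \<open>q = 2m - 2\<close> is large enough for the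
  powers of \<open>s + \<epsilon>\<close> in the denominator to absorb those of \<open>s\<close>, and what is left is \<open>(t + \<epsilon>)\<^bsup>q\<^esup>\<close>.
\<close>

lemma competition_term_bound_ordered:
  fixes s t \<epsilon> m :: real
  assumes "t > 0" "s \<ge> t" and \<epsilon>: "\<epsilon> > 0" and m: "m > 1"
  defines "q \<equiv> 2 * m - 2"
  shows "(s powr m - t powr m) * (s powr (m - 1) * test_factor q (s + \<epsilon>) (t + \<epsilon>)
      - t powr (m - 1) * test_factor q (t + \<epsilon>) (s + \<epsilon>)) \<le> (2 * \<epsilon>) powr q"
    (is "?D * (?A - ?B) \<le> _")
proof -
  define S where "S = s + \<epsilon>"
  define T where "T = t + \<epsilon>"
  have pos: "s > 0" "S > 0" "T > 0" "T \<le> S" "s \<le> S" using assms by (auto simp: S_def T_def)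
  have D: "0 \<le> ?D" "?D \<le> s powr m" using assms by (auto intro!: powr_mono2)
  have B: "?B \<ge> 0" using weight_bounds(1)[OF pos(3,2)] pos by (simp add: test_factor_def S_def T_def)
  show ?thesis
  proof (cases "t < \<epsilon>")
    case True
    have "?D * (?A - ?B) \<le> s powr m * ?A"
    proof -
      have "?D * (?A - ?B) \<le> ?D * ?A" using B D by (intro mult_left_mono) auto
      also have "\<dots> \<le> s powr m * ?A"
        using D weight_bounds(1)[OF pos(2,3)] pos by (intro mult_right_mono) (auto simp: test_factor_def S_def T_def)
      finally show ?thesis .
    qed
    also have "s powr m * ?A = s powr (q + 1) * (weight q S T / S)"
      unfolding q_def test_factor_def S_def[symmetric] T_def[symmetric]
      using powr_add[of s m "m - 1"] by (simp add: mult.assoc)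
    also have "\<dots> \<le> S powr (q + 1) * ((T powr q / S powr q) / S)"
    proof (intro mult_mono divide_right_mono)
      show "weight q S T \<le> T powr q / S powr q"
        unfolding weight_def using pos add_powr_pos[OF pos(2), of q T]
        by (intro divide_left_mono mult_pos_pos) auto
    qed (use pos m weight_bounds(1)[OF pos(2,3)] in \<open>auto simp: q_def intro!: powr_mono2 divide_nonneg_pos\<close>)
    also have "\<dots> = T powr q"
      using pos by (simp add: powr_add)
    also have "\<dots> \<le> (2 * \<epsilon>) powr q"
      using True pos m by (intro powr_mono2) (auto simp: T_def q_def)
    finally show ?thesis .
  next
    case False
    \<comment> \<open>Equivalent to \<open>s (t + \<epsilon>)\<^sup>2 \<le> t (s + \<epsilon>)\<^sup>2\<close>, which compares the two test factors.\<close>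
    have "0 \<le> (s - t) * (s * t - \<epsilon>\<^sup>2)"
      using False assms(2) \<epsilon> by (intro mult_nonneg_nonneg) (auto simp: power2_eq_square intro!: mult_mono)
    then have "s * T\<^sup>2 \<le> t * S\<^sup>2"
      unfolding S_def T_def by (simp add: power2_eq_square algebra_simps)
    then have "(s * T\<^sup>2) powr (m - 1) \<le> (t * S\<^sup>2) powr (m - 1)"
      using pos m by (intro powr_mono2) auto
    moreover have "(x * y\<^sup>2) powr (m - 1) = x powr (m - 1) * y powr q" if "x > 0" "y > 0" for x y :: real
    proof -
      have "y\<^sup>2 = y powr 2" using that by simp
      then show ?thesis using that by (simp only: powr_mult powr_powr q_def) (simp add: algebra_simps)
    qed
    ultimately have num: "s powr (m - 1) * T powr q \<le> t powr (m - 1) * S powr q"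
      using pos assms(1) by simp
    have "s powr (m - 1) * T powr q / (S * (S powr q + T powr q))
        \<le> t powr (m - 1) * S powr q / (T * (T powr q + S powr q))"
    proof (rule frac_le)
      show "T * (T powr q + S powr q) \<le> S * (S powr q + T powr q)"
        using pos by (subst add.commute) (auto intro!: mult_right_mono)
    qed (use pos num in \<open>auto intro!: mult_pos_pos add_powr_pos\<close>)
    then have "?A - ?B \<le> 0"
      by (simp add: test_factor_def weight_def S_def T_def mult.commute)
    with D have "?D * (?A - ?B) \<le> 0" by (simp add: mult_nonneg_nonpos)
    then show ?thesis using powr_ge_zero order_trans by blast
  qed
qed

lemma competition_term_bound:
  fixes s t \<epsilon> m :: real
  assumes "s > 0" "t > 0" and \<epsilon>: "\<epsilon> > 0" and m: "m > 1"
  defines "q \<equiv> 2 * m - 2"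
  shows "(s powr m - t powr m) * (s powr (m - 1) * test_factor q (s + \<epsilon>) (t + \<epsilon>)
      - t powr (m - 1) * test_factor q (t + \<epsilon>) (s + \<epsilon>)) \<le> (2 * \<epsilon>) powr q"
proof (cases "s \<ge> t")
  case True
  then show ?thesis using competition_term_bound_ordered[of t s \<epsilon> m] assms by simp
next
  case False
  then show ?thesis using competition_term_bound_ordered[of s t \<epsilon> m] assms by (simp add: algebra_simps)
qed

text \<open>
  The two nonlinearities, multiplied by their test factors, add up to at least \<open>l1\<close> up to errors that
  vanish with \<open>\<epsilon>\<close>. Since \<open>\<beta> \<ge> 1\<close>, the right-hand sides are at least
  \<open>l1 s - s\<^bsup>m-1\<^esup> (s\<^bsup>m\<^esup> - t\<^bsup>m\<^esup>)\<close> and \<open>l1 t + t\<^bsup>m-1\<^esup> (s\<^bsup>m\<^esup> - t\<^bsup>m\<^esup>)\<close> with \<open>m = p/2\<close>. The nonlinear parts combine to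
  the competition term, and the linear parts give \<open>l1\<close> times the sum of the weights, up to the
  difference between \<open>s / (s + \<epsilon>)\<close> and one.
\<close>

lemma reaction_lower_bound:
  fixes s t \<epsilon> p :: real
  assumes s: "s > 0" and t: "t > 0" and \<epsilon>: "\<epsilon> > 0" and p: "p > 2" and \<beta>: "\<beta> \<ge> 1" and l: "l1 \<le> l2"
  defines "q \<equiv> p - 2"
  shows "l1 - \<bar>l1\<bar> * (\<epsilon> / (s + \<epsilon>) + \<epsilon> / (t + \<epsilon>)) - (2 * \<epsilon>) powr q
    \<le> (l1 * s - \<bar>s\<bar> powr (p - 2) * s + \<beta> * (\<bar>s\<bar> powr (p/2 - 2) * s) * \<bar>t\<bar> powr (p/2)) * test_factor q (s + \<epsilon>) (t + \<epsilon>)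
      + (l2 * t - \<bar>t\<bar> powr (p - 2) * t + \<beta> * \<bar>s\<bar> powr (p/2) * (\<bar>t\<bar> powr (p/2 - 2) * t)) * test_factor q (t + \<epsilon>) (s + \<epsilon>)"
proof -
  define m where "m = p / 2"
  define a where "a = weight q (s + \<epsilon>) (t + \<epsilon>)"
  define b where "b = weight q (t + \<epsilon>) (s + \<epsilon>)"
  define A where "A = test_factor q (s + \<epsilon>) (t + \<epsilon>)"
  define B where "B = test_factor q (t + \<epsilon>) (s + \<epsilon>)"
  have q: "q = 2 * m - 2" and m: "m > 1" using p by (simp_all add: q_def m_def)
  have st: "s + \<epsilon> > 0" "t + \<epsilon> > 0" using s t \<epsilon> by auto
  have ab: "0 \<le> a" "a \<le> 1" "0 \<le> b" "b \<le> 1" "b = 1 - a"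
    unfolding a_def b_def using weight_bounds[OF st] weight_bounds[OF st(2,1)] weight_swap[OF st] by blast+
  have AB: "A = a / (s + \<epsilon>)" "B = b / (t + \<epsilon>)"
    by (simp_all add: A_def B_def test_factor_def a_def b_def)
  have AB_nonneg: "A \<ge> 0" "B \<ge> 0" using AB ab st by auto
  have pw: "x powr (m - 2) * x = x powr (m - 1)" "x powr (p - 2) * x = x powr (m - 1) * x powr m" if "x > 0" for x :: real
  proof -
    have "x powr (m - 2) * x = x powr (1 + (m - 2))" "x powr (p - 2) * x = x powr (1 + (p - 2))"
      using powr_mult_base[of x] that by (simp_all add: mult.commute)
    moreover have "1 + (m - 2) = m - 1" "1 + (p - 2) = (m - 1) + m" by (simp_all add: m_def)
    ultimately show "x powr (m - 2) * x = x powr (m - 1)" "x powr (p - 2) * x = x powr (m - 1) * x powr m"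
      by (simp_all only: powr_add)
  qed
  have fu: "l1 * s - s powr (m - 1) * (s powr m - t powr m)
      \<le> l1 * s - \<bar>s\<bar> powr (p - 2) * s + \<beta> * (\<bar>s\<bar> powr (p/2 - 2) * s) * \<bar>t\<bar> powr (p/2)"
  proof -
    have "1 * (s powr (m - 1) * t powr m) \<le> \<beta> * (s powr (m - 1) * t powr m)"
      using \<beta> by (intro mult_right_mono) auto
    then show ?thesis using s t pw[OF s] by (simp add: m_def[symmetric] algebra_simps)
  qed
  have fv: "l1 * t + t powr (m - 1) * (s powr m - t powr m)
      \<le> l2 * t - \<bar>t\<bar> powr (p - 2) * t + \<beta> * \<bar>s\<bar> powr (p/2) * (\<bar>t\<bar> powr (p/2 - 2) * t)"
  proof -
    have "1 * (t powr (m - 1) * s powr m) \<le> \<beta> * (t powr (m - 1) * s powr m)"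
      using \<beta> by (intro mult_right_mono) auto
    moreover have "l1 * t \<le> l2 * t" using l t by simp
    moreover have "l2 * t - \<bar>t\<bar> powr (p - 2) * t + \<beta> * \<bar>s\<bar> powr (p/2) * (\<bar>t\<bar> powr (p/2 - 2) * t)
        = l2 * t - t powr (m - 1) * t powr m + \<beta> * (t powr (m - 1) * s powr m)"
      using s t pw[OF t] by (simp add: m_def[symmetric])
    ultimately show ?thesis unfolding right_diff_distrib by linarith
  qed
  have "\<bar>l1 * (s * A + t * B) - l1\<bar> \<le> \<bar>l1\<bar> * (\<epsilon> / (s + \<epsilon>) + \<epsilon> / (t + \<epsilon>))"
  proof -
    have "s * A + t * B - 1 = - (a * (\<epsilon> / (s + \<epsilon>)) + b * (\<epsilon> / (t + \<epsilon>)))"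
      unfolding AB ab(5) using st by (simp add: divide_simps) (simp add: algebra_simps)
    moreover have "0 \<le> a * (\<epsilon> / (s + \<epsilon>))" "0 \<le> b * (\<epsilon> / (t + \<epsilon>))" using ab \<epsilon> st by auto
    moreover have "a * (\<epsilon> / (s + \<epsilon>)) \<le> 1 * (\<epsilon> / (s + \<epsilon>))" "b * (\<epsilon> / (t + \<epsilon>)) \<le> 1 * (\<epsilon> / (t + \<epsilon>))"
      by (rule mult_right_mono[OF ab(2)], use \<epsilon> st in simp, rule mult_right_mono[OF ab(4)], use \<epsilon> st in simp)
    ultimately have "\<bar>s * A + t * B - 1\<bar> \<le> \<epsilon> / (s + \<epsilon>) + \<epsilon> / (t + \<epsilon>)" by linarith
    then have "\<bar>l1\<bar> * \<bar>s * A + t * B - 1\<bar> \<le> \<bar>l1\<bar> * (\<epsilon> / (s + \<epsilon>) + \<epsilon> / (t + \<epsilon>))"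
      by (intro mult_left_mono) auto
    then show ?thesis by (simp add: abs_mult[symmetric] right_diff_distrib)
  qed
  then have "l1 - \<bar>l1\<bar> * (\<epsilon> / (s + \<epsilon>) + \<epsilon> / (t + \<epsilon>)) - (2 * \<epsilon>) powr q
      \<le> l1 * (s * A + t * B) - (s powr m - t powr m) * (s powr (m - 1) * A - t powr (m - 1) * B)"
    using competition_term_bound[OF s t \<epsilon> m] unfolding A_def B_def q by linarith
  also have "\<dots> = (l1 * s - s powr (m - 1) * (s powr m - t powr m)) * A
      + (l1 * t + t powr (m - 1) * (s powr m - t powr m)) * B"
    by (simp add: algebra_simps)
  also have "\<dots> \<le> (l1 * s - \<bar>s\<bar> powr (p - 2) * s + \<beta> * (\<bar>s\<bar> powr (p/2 - 2) * s) * \<bar>t\<bar> powr (p/2)) * A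
      + (l2 * t - \<bar>t\<bar> powr (p - 2) * t + \<beta> * \<bar>s\<bar> powr (p/2) * (\<bar>t\<bar> powr (p/2 - 2) * t)) * B"
    by (rule add_mono[OF mult_right_mono[OF fu AB_nonneg(1)] mult_right_mono[OF fv AB_nonneg(2)]])
  finally show ?thesis unfolding A_def B_def .
qed

section \<open>Comparison with the Dirichlet energy\<close>

text \<open>
  The expression is the lower bound for the reaction terms. Its bound does not depend on \<open>s\<close> and \<open>t\<close>
  and thus supplies an integrable majorant.
\<close>

lemma regularised_rate_bound:
  fixes l s t d q :: real
  assumes "d > 0"
  shows "\<bar>l - \<bar>l\<bar> * (d / (\<bar>s\<bar> + d) + d / (\<bar>t\<bar> + d)) - (2 * d) powr q\<bar> \<le> 3 * \<bar>l\<bar> + (2 * d) powr q"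
proof -
  have "0 \<le> d / (\<bar>r\<bar> + d) \<and> d / (\<bar>r\<bar> + d) \<le> 1" for r
    using assms by (auto simp: divide_le_eq_1)
  from this[of s] this[of t]
  have "\<bar>l\<bar> * (d / (\<bar>s\<bar> + d) + d / (\<bar>t\<bar> + d)) \<le> \<bar>l\<bar> * 2" "0 \<le> \<bar>l\<bar> * (d / (\<bar>s\<bar> + d) + d / (\<bar>t\<bar> + d))"
    by (auto intro!: mult_left_mono)
  moreover have "0 \<le> (2 * d) powr q" by simp
  ultimately show ?thesis by linarith
qed

text \<open>
  The two equations, tested with \<open>\<phi>\<^sup>2\<close> times the respective test factor, are added: the pointwise lower
  bound on the reaction terms meets Picone's inequality on the gradient side. The absolute
  values in the denominators only serve to bound the integrand everywhere and not just where \<open>u\<close> and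
  \<open>v\<close> are positive.
\<close>

lemma regularised_energy_bound:
  fixes u v :: "'a::euclidean_space \<Rightarrow> real"
  assumes \<Omega>: "\<Omega> \<in> sets lebesgue" and sol: "LS_solution \<Omega> p \<beta> l1 l2 u v"
    and apu: "H10_approximates \<Omega> u Du un" and apv: "H10_approximates \<Omega> v Dv vn"
    and upos: "AE x in lebesgue_on \<Omega>. u x > 0" and vpos: "AE x in lebesgue_on \<Omega>. v x > 0"
    and p: "p > 2" and \<beta>: "\<beta> \<ge> 1" and l: "l1 \<le> l2"
    and \<phi>: "\<phi> \<in> test_functions \<Omega>" and \<epsilon>: "\<epsilon> > 0"
  shows "(LINT x|lebesgue_on \<Omega>. (\<phi> x)\<^sup>2 *
      (l1 - \<bar>l1\<bar> * (\<epsilon> / (\<bar>u x\<bar> + \<epsilon>) + \<epsilon> / (\<bar>v x\<bar> + \<epsilon>)) - (2 * \<epsilon>) powr (p - 2)))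
    \<le> (LINT x|lebesgue_on \<Omega>. (norm (gradient \<phi> x))\<^sup>2)"
proof -
  let ?M = "lebesgue_on \<Omega>"
  define q where "q = p - 2"
  have q: "q > 0" using p by (simp add: q_def)
  let ?fu = "\<lambda>x. l1 * u x - \<bar>u x\<bar> powr (p - 2) * u x + \<beta> * (\<bar>u x\<bar> powr (p/2 - 2) * u x) * \<bar>v x\<bar> powr (p/2)"
  let ?fv = "\<lambda>x. l2 * v x - \<bar>v x\<bar> powr (p - 2) * v x + \<beta> * \<bar>u x\<bar> powr (p/2) * (\<bar>v x\<bar> powr (p/2 - 2) * v x)"
  have sols: "weak_poisson_solution \<Omega> ?fu u" "weak_poisson_solution \<Omega> ?fv v"
    using sol by (simp_all add: LS_solution_def)
  note tu = weak_poisson_test_weighted[OF \<Omega> sols(1) apu apv upos vpos \<phi> \<epsilon> q]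
  note tv = weak_poisson_test_weighted[OF \<Omega> sols(2) apv apu vpos upos \<phi> \<epsilon> q]
  let ?Lu = "\<lambda>x. ?fu x * ((\<phi> x)\<^sup>2 * test_factor q (u x + \<epsilon>) (v x + \<epsilon>))"
  let ?Lv = "\<lambda>x. ?fv x * ((\<phi> x)\<^sup>2 * test_factor q (v x + \<epsilon>) (u x + \<epsilon>))"
  let ?Gu = "\<lambda>x. 2 * \<phi> x * test_factor q (u x + \<epsilon>) (v x + \<epsilon>) * (Du x \<bullet> gradient \<phi> x)
      + (\<phi> x)\<^sup>2 * test_factor_d1 q (u x + \<epsilon>) (v x + \<epsilon>) * (Du x \<bullet> Du x)
      + (\<phi> x)\<^sup>2 * test_factor_d2 q (u x + \<epsilon>) (v x + \<epsilon>) * (Du x \<bullet> Dv x)"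
  let ?Gv = "\<lambda>x. 2 * \<phi> x * test_factor q (v x + \<epsilon>) (u x + \<epsilon>) * (Dv x \<bullet> gradient \<phi> x)
      + (\<phi> x)\<^sup>2 * test_factor_d1 q (v x + \<epsilon>) (u x + \<epsilon>) * (Dv x \<bullet> Dv x)
      + (\<phi> x)\<^sup>2 * test_factor_d2 q (v x + \<epsilon>) (u x + \<epsilon>) * (Dv x \<bullet> Du x)"
  let ?K = "\<lambda>x. l1 - \<bar>l1\<bar> * (\<epsilon> / (\<bar>u x\<bar> + \<epsilon>) + \<epsilon> / (\<bar>v x\<bar> + \<epsilon>)) - (2 * \<epsilon>) powr (p - 2)"
  have Lint: "integrable ?M ?Lu" "integrable ?M ?Lv"
    using tu(2) tv(2) by (auto simp: has_bochner_integral_iff)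
  have L2: "u \<in> L2 \<Omega>" "v \<in> L2 \<Omega>"
    using apu apv by (auto simp: H10_approximates_def L2_weak_gradient_def)
  note [measurable] = L2[THEN L2_measurable] smooth_measurable_lebesgue_on(1)[OF test_functions_smooth[OF \<phi>] \<Omega>]
  note K_bound = regularised_rate_bound[OF \<epsilon>, of l1 "u x" "v x" "p - 2" for x]
  have Kint: "integrable ?M (\<lambda>x. (\<phi> x)\<^sup>2 * ?K x)"
  proof (rule Bochner_Integration.integrable_bound)
    show "integrable ?M (\<lambda>x. (\<phi> x)\<^sup>2 * (3 * \<bar>l1\<bar> + (2 * \<epsilon>) powr (p - 2)))"
      using L2_integrable[OF test_functions_L2(1)[OF \<phi> \<Omega>]] by simp
    show "AE x in ?M. norm ((\<phi> x)\<^sup>2 * ?K x) \<le> norm ((\<phi> x)\<^sup>2 * (3 * \<bar>l1\<bar> + (2 * \<epsilon>) powr (p - 2)))"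
      unfolding norm_mult by (intro AE_I2 mult_left_mono) (auto intro: order_trans[OF K_bound])
  qed measurable
  have "(LINT x|?M. (\<phi> x)\<^sup>2 * ?K x) \<le> (LINT x|?M. ?Lu x + ?Lv x)"
  proof (rule integral_mono_AE)
    show "AE x in ?M. (\<phi> x)\<^sup>2 * ?K x \<le> ?Lu x + ?Lv x"
      using upos vpos
    proof eventually_elim
      case (elim x)
      have "(\<phi> x)\<^sup>2 * ?K x \<le> (\<phi> x)\<^sup>2 * (?fu x * test_factor q (u x + \<epsilon>) (v x + \<epsilon>) + ?fv x * test_factor q (v x + \<epsilon>) (u x + \<epsilon>))"
        using reaction_lower_bound[OF elim \<epsilon> p \<beta> l] elim unfolding q_def by (intro mult_left_mono) simp_all
      also have "\<dots> = ?Lu x + ?Lv x" by (simp only: distrib_left mult.left_commute)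
      finally show ?case .
    qed
  qed (use Kint Lint in auto)
  also have "(LINT x|?M. ?Lu x + ?Lv x) = (LINT x|?M. ?Lu x) + (LINT x|?M. ?Lv x)"
    by (rule Bochner_Integration.integral_add[OF Lint])
  also have "\<dots> = (LINT x|?M. ?Gu x + ?Gv x)"
    unfolding has_bochner_integral_integral_eq[OF tu(2)] has_bochner_integral_integral_eq[OF tv(2)]
    by (rule Bochner_Integration.integral_add[OF tu(1) tv(1), symmetric])
  also have "\<dots> \<le> (LINT x|?M. (norm (gradient \<phi> x))\<^sup>2)"
  proof (rule integral_mono_AE[OF Bochner_Integration.integrable_add[OF tu(1) tv(1)]])
    show "integrable ?M (\<lambda>x. (norm (gradient \<phi> x))\<^sup>2)"
      by (rule L2_integrable[OF test_functions_L2(2)[OF \<phi> \<Omega>]])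
  next
    show "AE x in ?M. ?Gu x + ?Gv x \<le> (norm (gradient \<phi> x))\<^sup>2"
      using upos vpos by eventually_elim (rule picone_inequality_pair; use \<epsilon> q in simp)
  qed
  finally show ?thesis .
qed

text \<open>
  The limit \<open>\<epsilon> \<rightarrow> 0\<close> of the regularised bound: positivity of \<open>u\<close> and \<open>v\<close> makes \<open>\<epsilon> / (u + \<epsilon>)\<close> and
  \<open>\<epsilon> / (v + \<epsilon>)\<close> tend to zero almost everywhere.
\<close>

lemma energy_bound:
  fixes u v :: "'a::euclidean_space \<Rightarrow> real"
  assumes \<Omega>: "\<Omega> \<in> sets lebesgue" and sol: "LS_solution \<Omega> p \<beta> l1 l2 u v"
    and upos: "AE x in lebesgue_on \<Omega>. u x > 0" and vpos: "AE x in lebesgue_on \<Omega>. v x > 0"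
    and p: "p > 2" and \<beta>: "\<beta> \<ge> 1" and l: "l1 \<le> l2"
    and \<phi>: "\<phi> \<in> test_functions \<Omega>"
  shows "l1 * (LINT x|lebesgue_on \<Omega>. (\<phi> x)\<^sup>2) \<le> (LINT x|lebesgue_on \<Omega>. (norm (gradient \<phi> x))\<^sup>2)"
proof -
  let ?M = "lebesgue_on \<Omega>"
  have H10: "u \<in> H10 \<Omega>" "v \<in> H10 \<Omega>"
    using sol by (auto simp: LS_solution_def weak_poisson_solution_def)
  obtain Du un where apu: "H10_approximates \<Omega> u Du un" by (rule H10_approximation[OF H10(1) \<Omega>])
  obtain Dv vn where apv: "H10_approximates \<Omega> v Dv vn" by (rule H10_approximation[OF H10(2) \<Omega>])
  have L2: "u \<in> L2 \<Omega>" "v \<in> L2 \<Omega>"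
    using apu apv by (auto simp: H10_approximates_def L2_weak_gradient_def)
  note [measurable] = L2[THEN L2_measurable] smooth_measurable_lebesgue_on(1)[OF test_functions_smooth[OF \<phi>] \<Omega>]
  define d where "d = (\<lambda>n. 1 / real (Suc n))"
  have d: "d n > 0" "d n \<le> 1" "d \<longlonglongrightarrow> 0" for n
    using LIMSEQ_inverse_Suc by (auto simp: d_def divide_simps)
  define K where "K = (\<lambda>n x. l1 - \<bar>l1\<bar> * (d n / (\<bar>u x\<bar> + d n) + d n / (\<bar>v x\<bar> + d n)) - (2 * d n) powr (p - 2))"
  have lim: "(\<lambda>n. LINT x|?M. (\<phi> x)\<^sup>2 * K n x) \<longlonglongrightarrow> (LINT x|?M. (\<phi> x)\<^sup>2 * l1)"
  proof (rule integral_dominated_convergence[where w="\<lambda>x. (\<phi> x)\<^sup>2 * (3 * \<bar>l1\<bar> + 2 powr (p - 2))"])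
    show "(\<lambda>x. (\<phi> x)\<^sup>2 * l1) \<in> borel_measurable ?M" "(\<lambda>x. (\<phi> x)\<^sup>2 * K n x) \<in> borel_measurable ?M" for n
      unfolding K_def by measurable
    show "integrable ?M (\<lambda>x. (\<phi> x)\<^sup>2 * (3 * \<bar>l1\<bar> + 2 powr (p - 2)))"
      using L2_integrable[OF test_functions_L2(1)[OF \<phi> \<Omega>]] by simp
    have powr_lim: "(\<lambda>n. (2 * d n) powr (p - 2)) \<longlonglongrightarrow> 0"
      using tendsto_powr'[of "\<lambda>n. 2 * d n" 0 sequentially "\<lambda>n. p - 2" "p - 2"] tendsto_mult_left[OF d(3), of 2] d(1) p
      by (simp add: less_imp_le)
    show "AE x in ?M. (\<lambda>n. (\<phi> x)\<^sup>2 * K n x) \<longlonglongrightarrow> (\<phi> x)\<^sup>2 * l1"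
      using upos vpos
    proof eventually_elim
      case (elim x)
      have ratio: "(\<lambda>n. d n / (\<bar>s\<bar> + d n)) \<longlonglongrightarrow> 0" if "s > 0" for s :: real
        using tendsto_divide[OF d(3) tendsto_add[OF tendsto_const[of "\<bar>s\<bar>"] d(3)]] that by simp
      have "(\<lambda>n. (\<phi> x)\<^sup>2 * K n x) \<longlonglongrightarrow> (\<phi> x)\<^sup>2 * (l1 - \<bar>l1\<bar> * (0 + 0) - 0)"
        unfolding K_def by (intro tendsto_mult tendsto_diff tendsto_add tendsto_const ratio elim powr_lim)
      then show ?case by simp
    qed
    show "AE x in ?M. norm ((\<phi> x)\<^sup>2 * K n x) \<le> (\<phi> x)\<^sup>2 * (3 * \<bar>l1\<bar> + 2 powr (p - 2))" for n
    proof (rule AE_I2)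
      fix x
      have "(2 * d n) powr (p - 2) \<le> 2 powr (p - 2)"
        using d(1,2)[of n] p by (intro powr_mono2) (auto intro: less_imp_le)
      with regularised_rate_bound[OF d(1)[of n], of l1 "u x" "v x" "p - 2"]
      have "\<bar>K n x\<bar> \<le> 3 * \<bar>l1\<bar> + 2 powr (p - 2)" unfolding K_def by linarith
      then show "norm ((\<phi> x)\<^sup>2 * K n x) \<le> (\<phi> x)\<^sup>2 * (3 * \<bar>l1\<bar> + 2 powr (p - 2))"
        by (simp add: abs_mult mult_left_mono)
    qed
  qed
  have "(LINT x|?M. (\<phi> x)\<^sup>2 * l1) \<le> (LINT x|?M. (norm (gradient \<phi> x))\<^sup>2)"
    by (rule LIMSEQ_le_const2[OF lim])
      (use regularised_energy_bound[OF \<Omega> sol apu apv upos vpos p \<beta> l \<phi> d(1)] in \<open>auto simp: K_def\<close>)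
  then show ?thesis by (simp add: mult.commute)
qed

text \<open>
  By density the energy bound extends from test functions to an eigenfunction \<open>w\<close>, whose energy is
  \<open>\<mu>\<close> times its squared norm.
\<close>

lemma energy_bound_le_dirichlet_eigenvalue:
  fixes \<Omega> :: "'a::euclidean_space set"
  assumes \<Omega>: "\<Omega> \<in> sets lebesgue" and \<mu>: "dirichlet_eigenvalue \<Omega> \<mu>"
    and bound: "\<And>\<phi>. \<phi> \<in> test_functions \<Omega> \<Longrightarrow>
      l * (LINT x|lebesgue_on \<Omega>. (\<phi> x)\<^sup>2) \<le> (LINT x|lebesgue_on \<Omega>. (norm (gradient \<phi> x))\<^sup>2)"
  shows "l \<le> \<mu>"
proof -
  let ?M = "lebesgue_on \<Omega>"
  obtain w where w0: "\<not> (AE x in ?M. w x = 0)" and sol: "weak_poisson_solution \<Omega> (\<lambda>x. \<mu> * w x) w"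
    using \<mu> by (auto simp: dirichlet_eigenvalue_def)
  have w_H10: "w \<in> H10 \<Omega>" using sol by (simp add: weak_poisson_solution_def)
  obtain Dw \<phi> where "H10_approximates \<Omega> w Dw \<phi>"
    by (rule H10_approximation[OF w_H10 \<Omega>])
  then have wg: "L2_weak_gradient \<Omega> w Dw" and \<phi>: "\<And>n::nat. \<phi> n \<in> test_functions \<Omega>"
    and lim: "(\<lambda>n. LINT x|?M. (norm (w x - \<phi> n x))\<^sup>2) \<longlonglongrightarrow> 0"
      "(\<lambda>n. LINT x|?M. (norm (Dw x - gradient (\<phi> n) x))\<^sup>2) \<longlonglongrightarrow> 0"
    by (simp_all add: H10_approximates_def)
  have L2: "w \<in> L2 \<Omega>" "Dw \<in> L2 \<Omega>" using wg by (auto simp: L2_weak_gradient_def)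
  have lim2: "(\<lambda>n. LINT x|?M. (norm (\<phi> n x))\<^sup>2) \<longlonglongrightarrow> (LINT x|?M. (norm (w x))\<^sup>2)"
    "(\<lambda>n. LINT x|?M. (norm (gradient (\<phi> n) x))\<^sup>2) \<longlonglongrightarrow> (LINT x|?M. (norm (Dw x))\<^sup>2)"
    using L2_tendsto_norm2[OF L2(1) test_functions_L2(1)[OF \<phi> \<Omega>] lim(1)]
      L2_tendsto_norm2[OF L2(2) test_functions_L2(2)[OF \<phi> \<Omega>] lim(2)] .
  have "l * (LINT x|?M. (norm (w x))\<^sup>2) \<le> (LINT x|?M. (norm (Dw x))\<^sup>2)"
    by (rule LIMSEQ_le[OF tendsto_mult_left[OF lim2(1)] lim2(2)]) (use bound[OF \<phi>] in auto)
  also have "(LINT x|?M. (norm (Dw x))\<^sup>2) = (LINT x|?M. \<mu> * w x * w x)"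
  proof -
    have "has_bochner_integral ?M (\<lambda>x. \<mu> * w x * w x) (LINT x|?M. Dw x \<bullet> Dw x)"
      using sol w_H10 wg unfolding weak_poisson_solution_def by blast
    then show ?thesis by (simp add: has_bochner_integral_iff power2_norm_eq_inner)
  qed
  also have "\<dots> = \<mu> * (LINT x|?M. (norm (w x))\<^sup>2)"
    by (simp add: power2_eq_square mult.assoc)
  finally have le: "l * (LINT x|?M. (norm (w x))\<^sup>2) \<le> \<mu> * (LINT x|?M. (norm (w x))\<^sup>2)" .
  have "(LINT x|?M. (norm (w x))\<^sup>2) \<noteq> 0"
    using w0 integral_nonneg_eq_0_iff_AE[OF L2_integrable[OF L2(1)]] by simp
  moreover have "(LINT x|?M. (norm (w x))\<^sup>2) \<ge> 0" by (rule Bochner_Integration.integral_nonneg) simp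
  ultimately have "(LINT x|?M. (norm (w x))\<^sup>2) > 0" by linarith
  with le show ?thesis by (rule mult_right_le_imp_le)
qed

theorem theorem1p3:
  fixes \<Omega> :: "(real ^ 'n) set" and p \<beta> l1 l2 :: real
  assumes "CARD('n) \<ge> 2"
    and "open \<Omega>" and "connected \<Omega>" and "\<Omega> \<noteq> {}" and "bounded \<Omega>"
    and "2 < p" and "ereal p < critical_sobolev_exponent CARD('n)"
    and "\<beta> \<ge> 1"
    and "first_dirichlet_eigenvalue \<Omega> < ereal l1" and "l1 \<le> l2"
  shows "\<not> (\<exists>u v. LS_solution \<Omega> p \<beta> l1 l2 u v \<and>
                (AE x in lebesgue_on \<Omega>. u x > 0) \<and> (AE x in lebesgue_on \<Omega>. v x > 0))"
proof (intro notI, elim exE conjE)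
  fix u v
  assume sol: "LS_solution \<Omega> p \<beta> l1 l2 u v"
    and pos: "AE x in lebesgue_on \<Omega>. u x > 0" "AE x in lebesgue_on \<Omega>. v x > 0"
  have \<Omega>: "\<Omega> \<in> sets lebesgue" using \<open>open \<Omega>\<close> by simp
  obtain \<mu> where \<mu>: "dirichlet_eigenvalue \<Omega> \<mu>" "\<mu> < l1"
    using \<open>first_dirichlet_eigenvalue \<Omega> < ereal l1\<close>
    by (auto simp: first_dirichlet_eigenvalue_def INF_less_iff)
  have "l1 \<le> \<mu>"
    using energy_bound_le_dirichlet_eigenvalue[OF \<Omega> \<mu>(1)]
      energy_bound[OF \<Omega> sol pos \<open>2 < p\<close> \<open>\<beta> \<ge> 1\<close> \<open>l1 \<le> l2\<close>] by blast
  with \<mu>(2) show False by simp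
qed

end
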